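(* Assume that $\eta_\Pi<\rho_\Pi<1$ and $c_\Pi^{\mathrm{top}}(w^\star)>0$. Then $F^\Pi(k)\asymp\rho_\Pi^{\,k-1}$ as $k\to\infty$; that is, there exist constants $0<a\le b<\infty$ and $k_0$ such that $a\,\rho_\Pi^{\,k-1}\le F^\Pi(k)\le b\,\rho_\Pi^{\,k-1}$ for all $k\ge k_0$.
   Context: A task is a pair $(X,y)$ with $X\in\mathbb R^{n\times d}$, $y\in\mathbb R^n$ ($n\ge1$ may depend on the task) and $\operatorname{rank}(X)<d$. $\Pi$ is a probability distribution on tasks. Common-solution assumption: there is a fixed vector $w^\star\in\mathbb R^d$ with $y=Xw^\star$ for every task under consideration. Tasks $(X_1,y_1),(X_2,y_2),\dots$ are i.i.d. from $\Pi$, with $X_t\in\mathbb R^{n_t\times d}$. Write $X^+$ for the Moore–Penrose pseudoinverse and set $$P_t:=I-X_t^+X_t,\qquad C_t:=\tfrac1{n_t}X_t^\top X_t,\qquad X_\star:=w^\star w^{\star\top};$$ $P_t$ is the orthogonal projector onto $\operatorname{null}(X_t)$. Exact-fit iterates: $w_0=0$ and, for $t\ge1$, $w_t:=\arg\min\{\tfrac12\|w-w_{t-1}\|_2^2:\ w\in\mathbb R^d,\ X_tw=y_t\}$; equivalently $w_t=w_{t-1}+X_t^+(y_t-X_tw_{t-1})=w^\star+P_t(w_{t-1}-w^\star)$. Forgetting: $\ell_t(w):=\tfrac1{n_t}\|X_tw-y_t\|_2^2$ and $F^\Pi(k):=\mathbb E\big[\tfrac1k\sum_{t=1}^k\ell_t(w_k)\big]$.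 All expectations appearing are assumed finite; in particular $\mathbb E\|C_t\|_F<\infty$. Spectral objects: $\mathbb S^d$ is the space of symmetric $d\times d$ real matrices with the Frobenius inner product; $S_\Pi:\mathbb S^d\to\mathbb S^d$, $S_\Pi(A):=\mathbb E[P_tAP_t]$ (independent of $t$); $\rho_\Pi:=\|S_\Pi\|_{\mathrm{op},F}$ is the operator norm of $S_\Pi$ with respect to the Frobenius norm; $\mathcal E_\Pi:=\{Y\in\mathbb S^d:S_\Pi(Y)=\rho_\Pi Y\}$; $\mathcal Q_\Pi:\mathbb S^d\to\mathcal E_\Pi$ is the Frobenius-orthogonal projector onto $\mathcal E_\Pi$; $\eta_\Pi:=\|S_\Pi|_{\mathcal E_\Pi^\perp}\|_{\mathrm{op},F}$ (equal to $0$ if $\mathcal E_\Pi^\perp=\{0\}$); and $$c_\Pi^{\mathrm{top}}(w^\star):=\mathbb E\,\operatorname{tr}\!\big(\mathcal Q_\Pi(C_t)\,P_t\,\mathcal Q_\Pi(X_\star)\,P_t\big).$$ *)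

theory Defs
  imports "HOL-Probability.Probability"
begin

text \<open>
  A task is a triple \<open>(n, X, y)\<close>: \<open>X i\<close> is the \<open>i\<close>-th row of an \<open>n \<times> d\<close> matrix
  (\<open>d = CARD('d)\<close>) and \<open>y i\<close> the \<open>i\<close>-th entry of a vector of length \<open>n\<close>, for \<open>i < n\<close>.
  Entries at indices \<open>\<ge> n\<close> are required to be \<open>0\<close>, so that \<open>tasks\<close> is in bijection with
  the disjoint union over \<open>n \<ge> 1\<close> of the pairs in \<open>\<real>\<^sup>n\<^sup>\<times>\<^sup>d \<times> \<real>\<^sup>n\<close> with \<open>rank X < d\<close>.
\<close>

type_synonym 'd task = "nat \<times> (nat \<Rightarrow> real^'d) \<times> (nat \<Rightarrow> real)"

definition nrows :: "'d::finite task \<Rightarrow> nat" where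
  "nrows \<tau> = fst \<tau>"

definition dataX :: "'d::finite task \<Rightarrow> nat \<Rightarrow> real^'d" where
  "dataX \<tau> = fst (snd \<tau>)"

definition datay :: "'d::finite task \<Rightarrow> nat \<Rightarrow> real" where
  "datay \<tau> = snd (snd \<tau>)"

text \<open>The rank is the dimension of the row space, as in \<open>row_rank_def\<close>.\<close>

definition tasks :: "'d::finite task set" where
  "tasks = {\<tau>. nrows \<tau> \<ge> 1
      \<and> (\<forall>i\<ge>nrows \<tau>. dataX \<tau> i = 0 \<and> datay \<tau> i = 0)
      \<and> dim (dataX \<tau> ` {..<nrows \<tau>}) < CARD('d)}"

text \<open>
  The \<open>\<sigma>\<close>-algebra on tasks is the Borel one; on \<open>tasks\<close> the subspace topology of the product
  is that of the disjoint union of the Euclidean pieces.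
\<close>

definition task_space :: "'d::finite task measure" where
  "task_space = restrict_space borel tasks"

text \<open>\<open>fits \<tau> w\<close> is the linear system \<open>X w = y\<close>.\<close>

definition fits :: "'d::finite task \<Rightarrow> real^'d \<Rightarrow> bool" where
  "fits \<tau> w \<longleftrightarrow> (\<forall>i<nrows \<tau>. dataX \<tau> i \<bullet> w = datay \<tau> i)"

definition loss :: "'d::finite task \<Rightarrow> real^'d \<Rightarrow> real" where
  "loss \<tau> w = (1 / real (nrows \<tau>)) * (\<Sum>i<nrows \<tau>. (dataX \<tau> i \<bullet> w - datay \<tau> i)\<^sup>2)"

text \<open>
  The four Penrose equations for an \<open>n \<times> d\<close> matrix with rows \<open>X i\<close> and a \<open>d \<times> n\<close> matrix with
  columns \<open>B i\<close>, in the order \<open>X B X = X\<close>, \<open>B X B = B\<close>, \<open>X B\<close> symmetric, \<open>B X\<close> symmetric.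
  The entries of \<open>X B\<close> are \<open>X i \<bullet> B m\<close>.
\<close>

definition mat_BX :: "nat \<Rightarrow> (nat \<Rightarrow> real^'d) \<Rightarrow> (nat \<Rightarrow> real^'d) \<Rightarrow> real^'d^'d" where
  "mat_BX n B X = (\<chi> j l. \<Sum>i<n. B i $ j * X i $ l)"

definition is_pinv :: "nat \<Rightarrow> (nat \<Rightarrow> real^'d::finite) \<Rightarrow> (nat \<Rightarrow> real^'d) \<Rightarrow> bool" where
  "is_pinv n X B \<longleftrightarrow>
     (\<forall>i<n. (\<Sum>m<n. (X i \<bullet> B m) *\<^sub>R X m) = X i) \<and>
     (\<forall>i<n. (\<Sum>m<n. (X m \<bullet> B i) *\<^sub>R B m) = B i) \<and>
     (\<forall>i<n. \<forall>m<n. X i \<bullet> B m = X m \<bullet> B i) \<and>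
     transpose (mat_BX n B X) = mat_BX n B X"

definition pinv :: "nat \<Rightarrow> (nat \<Rightarrow> real^'d::finite) \<Rightarrow> nat \<Rightarrow> real^'d" where
  "pinv n X = (THE B. is_pinv n X B \<and> (\<forall>i\<ge>n. B i = 0))"

text \<open>\<open>P = I - X\<^sup>+ X\<close>\<close>

definition nullproj :: "'d::finite task \<Rightarrow> real^'d^'d" where
  "nullproj \<tau> = mat 1 - mat_BX (nrows \<tau>) (pinv (nrows \<tau>) (dataX \<tau>)) (dataX \<tau>)"

text \<open>\<open>C = X\<^sup>T X / n\<close>\<close>

definition covmat :: "'d::finite task \<Rightarrow> real^'d^'d" where
  "covmat \<tau> = (1 / real (nrows \<tau>)) *\<^sub>R mat_BX (nrows \<tau>) (dataX \<tau>) (dataX \<tau>)"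

definition outer :: "real^'d \<Rightarrow> real^'d^'d" where
  "outer w = (\<chi> i j. w $ i * w $ j)"

text \<open>In a task sequence only the indices \<open>t \<ge> 1\<close> are used.\<close>

primrec iterate :: "(nat \<Rightarrow> 'd::finite task) \<Rightarrow> nat \<Rightarrow> real^'d" where
  "iterate T 0 = 0"
| "iterate T (Suc t) = arg_min (\<lambda>w. 1/2 * (norm (w - iterate T t))\<^sup>2) (fits (T (Suc t)))"

definition forgetting :: "'a measure \<Rightarrow> (nat \<Rightarrow> 'a \<Rightarrow> 'd::finite task) \<Rightarrow> nat \<Rightarrow> real" where
  "forgetting M T k =
     (\<integral>\<omega>. (1 / real k) * (\<Sum>t=1..k. loss (T t \<omega>) (iterate (\<lambda>s. T s \<omega>) k)) \<partial>M)"

text \<open>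
  The library's inner product and norm on \<open>real^'d^'d\<close> are the Frobenius ones.
\<close>

definition Sym :: "(real^'d^'d) set" where
  "Sym = {A. transpose A = A}"

text \<open>
  Operator norm of a linear map restricted to a subspace, cf. \<open>onorm\<close>; it is \<open>0\<close> on \<open>{0}\<close>
  since \<open>0 / 0 = 0\<close>.
\<close>

definition onorm_on :: "'v::real_normed_vector set \<Rightarrow> ('v \<Rightarrow> 'v) \<Rightarrow> real" where
  "onorm_on V f = (SUP x\<in>V. norm (f x) / norm x)"

definition S_op :: "'d::finite task measure \<Rightarrow> real^'d^'d \<Rightarrow> real^'d^'d" where
  "S_op D A = (\<integral>\<tau>. nullproj \<tau> ** A ** nullproj \<tau> \<partial>D)"

definition rho :: "'d::finite task measure \<Rightarrow> real" where
  "rho D = onorm_on Sym (S_op D)"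

definition E_top :: "'d::finite task measure \<Rightarrow> (real^'d^'d) set" where
  "E_top D = {Y \<in> Sym. S_op D Y = rho D *\<^sub>R Y}"

definition Q_top :: "'d::finite task measure \<Rightarrow> real^'d^'d \<Rightarrow> real^'d^'d" where
  "Q_top D A = (THE Y. Y \<in> E_top D \<and> (\<forall>Z\<in>E_top D. orthogonal (A - Y) Z))"

definition eta :: "'d::finite task measure \<Rightarrow> real" where
  "eta D = onorm_on (Sym \<inter> (E_top D)\<^sup>\<bottom>) (S_op D)"

definition c_top :: "'d::finite task measure \<Rightarrow> real^'d \<Rightarrow> real" where
  "c_top D w =
     (\<integral>\<tau>. trace (Q_top D (covmat \<tau>) ** nullproj \<tau> ** Q_top D (outer w) ** nullproj \<tau>) \<partial>D)"

end

theory Submission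
  imports Defs
begin

text \<open>
  Writing \<open>e\<^sub>k = w\<^sub>k - w\<^sup>*\<close>, one has \<open>e\<^sub>k = P\<^sub>k e\<^sub>k\<^sub>-\<^sub>1\<close>, and the loss on task \<open>t\<close> is the Frobenius product
  of \<open>C\<^sub>t\<close> with \<open>e\<^sub>k e\<^sub>k\<^sup>T\<close>. Integrating out the tasks one at a time from the last to the first, and
  using that \<open>S\<close> is self-adjoint to move it onto \<open>C\<^sub>t\<close>, the expected loss on task \<open>t\<close> is
  \<open>E[S\<^sup>k\<^sup>-\<^sup>t(C) \<bullet> P S\<^sup>t\<^sup>-\<^sup>1(X\<^sub>\<star>) P]\<close>. Since \<open>S\<^sup>m = \<rho>\<^sup>m Q + O(\<eta>\<^sup>m)\<close>, this differs from
  \<open>\<rho>\<^sup>k\<^sup>-\<^sup>1 c\<close> by \<open>O(\<eta>\<^sup>k\<^sup>-\<^sup>t \<rho>\<^sup>t\<^sup>-\<^sup>1 + \<rho>\<^sup>k\<^sup>-\<^sup>t \<eta>\<^sup>t\<^sup>-\<^sup>1)\<close>; these errors sum over \<open>t\<close> to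
  \<open>O(\<rho>\<^sup>k\<^sup>-\<^sup>1)\<close>, so averaging gives \<open>F(k) = \<rho>\<^sup>k\<^sup>-\<^sup>1 (c + O(1/k))\<close>.
\<close>

section \<open>Frobenius geometry and self-adjoint powers\<close>

lemma inner_matrix_mult_left:
  fixes A B C :: "real^'d::finite^'d"
  shows "(A ** B) \<bullet> C = B \<bullet> (transpose A ** C)"
proof -
  have "(A ** B) \<bullet> C = (\<Sum>i\<in>UNIV. \<Sum>j\<in>UNIV. \<Sum>l\<in>UNIV. A$i$l * B$l$j * C$i$j)"
    by (simp add: inner_vec_def matrix_matrix_mult_def sum_distrib_right)
  also have "\<dots> = (\<Sum>i\<in>UNIV. \<Sum>l\<in>UNIV. \<Sum>j\<in>UNIV. A$i$l * B$l$j * C$i$j)"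
    by (rule sum.cong[OF refl], rule sum.swap)
  also have "\<dots> = (\<Sum>l\<in>UNIV. \<Sum>i\<in>UNIV. \<Sum>j\<in>UNIV. A$i$l * B$l$j * C$i$j)"
    by (rule sum.swap)
  also have "\<dots> = (\<Sum>l\<in>UNIV. \<Sum>j\<in>UNIV. \<Sum>i\<in>UNIV. A$i$l * B$l$j * C$i$j)"
    by (rule sum.cong[OF refl], rule sum.swap)
  also have "\<dots> = B \<bullet> (transpose A ** C)"
    by (simp add: inner_vec_def matrix_matrix_mult_def sum_distrib_left transpose_def mult_ac)
  finally show ?thesis .
qed

lemma inner_transpose:
  fixes A B :: "real^'d::finite^'d"
  shows "transpose A \<bullet> transpose B = A \<bullet> B"
  unfolding inner_vec_def transpose_def by simp (rule sum.swap)

lemma inner_matrix_mult_right: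
  fixes A B C :: "real^'d::finite^'d"
  shows "(A ** B) \<bullet> C = A \<bullet> (C ** transpose B)"
proof -
  have "(A ** B) \<bullet> C = (transpose B ** transpose A) \<bullet> transpose C"
    using inner_transpose[of "A ** B" C] by (simp add: matrix_transpose_mul)
  also have "\<dots> = transpose A \<bullet> transpose (C ** transpose B)"
    by (simp add: inner_matrix_mult_left matrix_transpose_mul)
  finally show ?thesis by (simp add: inner_transpose)
qed

lemma trace_matrix_mult:
  fixes A B :: "real^'d::finite^'d"
  shows "trace (A ** B) = transpose A \<bullet> B"
  unfolding trace_def matrix_matrix_mult_def inner_vec_def transpose_def
  by simp (rule sum.swap)

lemma inner_compress:
  fixes A B P :: "real^'d::finite^'d"
  assumes "transpose P = P"
  shows "(P ** A ** P) \<bullet> B = A \<bullet> (P ** B ** P)"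
proof -
  have "(P ** A ** P) \<bullet> B = (P ** A) \<bullet> (B ** P)"
    using inner_matrix_mult_right[of "P ** A" P B] assms by simp
  also have "\<dots> = A \<bullet> (P ** (B ** P))"
    using inner_matrix_mult_left[of P A "B ** P"] assms by simp
  finally show ?thesis by (simp add: matrix_mul_assoc)
qed

text \<open>Symmetry and idempotence give \<open>|PAP|^2 = A \<bullet> PAP\<close>, and
  Cauchy-Schwarz cancels one factor. This uniform bound is the source of the domination in the
  integrability proofs below.\<close>

lemma norm_compress_le:
  fixes A P :: "real^'d::finite^'d"
  assumes "transpose P = P" "P ** P = P"
  shows "norm (P ** A ** P) \<le> norm A"
proof -
  have "P ** (P ** A ** P) ** P = P ** A ** P"
    using assms(2) by (metis matrix_mul_assoc)
  then have "(norm (P ** A ** P))\<^sup>2 = A \<bullet> (P ** A ** P)"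
    using inner_compress[OF assms(1), of A "P ** A ** P"] by (simp add: power2_norm_eq_inner)
  also have "\<dots> \<le> norm A * norm (P ** A ** P)"
    by (rule norm_cauchy_schwarz)
  finally show ?thesis
    by (cases "norm (P ** A ** P) = 0") (auto simp: power2_eq_square mult_right_le_imp_le)
qed

lemma bounded_bilinear_matrix_mult:
  "bounded_bilinear ((**) :: real^'d::finite^'d \<Rightarrow> real^'d^'d \<Rightarrow> real^'d^'d)"
  unfolding bilinear_conv_bounded_bilinear[symmetric] bilinear_def
  by (auto intro!: linearI simp: matrix_add_ldistrib vec_eq_iff matrix_matrix_mult_def
      sum.distrib algebra_simps sum_distrib_left)

lemma linear_compress: "linear (\<lambda>A. P ** A ** P :: real^'d::finite^'d)"
proof -
  interpret b: bounded_bilinear "(**) :: real^'d::finite^'d \<Rightarrow> real^'d^'d \<Rightarrow> real^'d^'d"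
    by (rule bounded_bilinear_matrix_mult)
  show ?thesis
    by (auto intro!: linearI simp: b.add_left b.add_right b.scaleR_left b.scaleR_right)
qed

lemma borel_measurable_matrix_mult [measurable (raw)]:
  fixes f g :: "'a \<Rightarrow> real^'d::finite^'d"
  assumes "f \<in> borel_measurable M" "g \<in> borel_measurable M"
  shows "(\<lambda>x. f x ** g x) \<in> borel_measurable M"
  using assms
  by (rule borel_measurable_continuous_Pair)
     (intro bounded_bilinear.continuous_on[OF bounded_bilinear_matrix_mult] continuous_intros)

text \<open>Measurability is tested against basis vectors, and \<open>axis i u\<close> sees only the
  \<open>i\<close>-th component. With it \<open>nullproj\<close> can be assembled from its
  entries.\<close>

lemma borel_measurable_vec_lambda [measurable (raw)]:
  fixes f :: "'i::finite \<Rightarrow> 'a \<Rightarrow> 'b::euclidean_space"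
  assumes "\<And>i. f i \<in> borel_measurable M"
  shows "(\<lambda>x. \<chi> i. f i x) \<in> borel_measurable M"
proof (subst borel_measurable_euclidean_space, rule ballI)
  fix b :: "'b^'i" assume "b \<in> Basis"
  then obtain i u where b: "b = axis i u"
    by (auto simp: Basis_vec_def)
  have "(\<lambda>x. (\<chi> i. f i x) \<bullet> b) = (\<lambda>x. f i x \<bullet> u)"
    by (simp add: b inner_axis)
  with assms show "(\<lambda>x. (\<chi> i. f i x) \<bullet> b) \<in> borel_measurable M"
    by simp
qed

lemma outer_matrix_vector_mult:
  "outer (P *v v) = P ** outer v ** transpose P" for P :: "real^'d::finite^'d"
  unfolding outer_def matrix_matrix_mult_def matrix_vector_mult_def transpose_def
  by (simp add: vec_eq_iff sum_product sum_distrib_right sum_distrib_left mult_ac)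

lemma subspace_Sym: "subspace (Sym :: (real^'d::finite^'d) set)"
  unfolding subspace_def Sym_def by (simp add: transpose_def vec_eq_iff)

section \<open>Orthogonal projection onto a subspace\<close>

text \<open>The description in \<open>Q_top\<close> with an arbitrary subspace in place of
  \<open>E_top D\<close>: one theory then serves both the eigenspace of matrices and the null spaces
  of the tasks.\<close>

definition orth_proj :: "'v::real_inner set \<Rightarrow> 'v \<Rightarrow> 'v" where
  "orth_proj E A = (THE Y. Y \<in> E \<and> (\<forall>Z\<in>E. orthogonal (A - Y) Z))"

context
  fixes E :: "'v::euclidean_space set"
  assumes E: "subspace E"
begin

lemma orth_proj_unique:
  assumes "Y \<in> E" "\<And>Z. Z \<in> E \<Longrightarrow> orthogonal (A - Y) Z"
  shows "orth_proj E A = Y"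
  unfolding orth_proj_def
proof (rule the_equality)
  show "Y \<in> E \<and> (\<forall>Z\<in>E. orthogonal (A - Y) Z)" using assms by blast
  fix Y' assume Y': "Y' \<in> E \<and> (\<forall>Z\<in>E. orthogonal (A - Y') Z)"
  have "Y' - Y \<in> E" using Y' assms(1) E by (simp add: subspace_diff)
  then have "orthogonal (A - Y) (Y' - Y)" "orthogonal (A - Y') (Y' - Y)"
    using Y' assms by auto
  then have "(Y' - Y) \<bullet> (Y' - Y) = 0"
    by (simp add: orthogonal_def inner_diff_left)
  then show "Y' = Y" by simp
qed

lemma orth_proj: "orth_proj E A \<in> E" "Z \<in> E \<Longrightarrow> orthogonal (A - orth_proj E A) Z"
proof -
  have s: "span E = E" using E by (simp add: span_eq_iff)
  obtain y z where yz: "y \<in> span E" "\<And>u. u \<in> span E \<Longrightarrow> orthogonal z u" "A = y + z"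
    using orthogonal_subspace_decomp_exists[of E A] by metis
  have "orth_proj E A = y"
    using yz s by (intro orth_proj_unique) auto
  then show "orth_proj E A \<in> E" "Z \<in> E \<Longrightarrow> orthogonal (A - orth_proj E A) Z"
    using yz s by auto
qed

lemma linear_orth_proj: "linear (orth_proj E)"
proof (rule linearI)
  fix A B c
  show "orth_proj E (A + B) = orth_proj E A + orth_proj E B"
    using orth_proj(1)[of A] orth_proj(1)[of B] orth_proj(2)[of _ A] orth_proj(2)[of _ B] E
    by (intro orth_proj_unique)
       (auto simp: subspace_add orthogonal_def algebra_simps inner_simps)
  show "orth_proj E (c *\<^sub>R A) = c *\<^sub>R orth_proj E A"
    using orth_proj(1)[of A] orth_proj(2)[of _ A] E
    by (intro orth_proj_unique)
       (auto simp: subspace_scale orthogonal_def inner_diff_left)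
qed

lemma norm_orth_proj:
  "(norm A)\<^sup>2 = (norm (orth_proj E A))\<^sup>2 + (norm (A - orth_proj E A))\<^sup>2"
  using norm_add_Pythagorean[of "orth_proj E A" "A - orth_proj E A"] orth_proj(1)[of A]
    orth_proj(2)[of "orth_proj E A" A]
  by (auto simp: orthogonal_commute)

lemma norm_orth_proj_le:
  "norm (orth_proj E A) \<le> norm A" "norm (A - orth_proj E A) \<le> norm A"
  using norm_orth_proj[of A] by (auto intro: power2_le_imp_le)

end

section \<open>Restricted operator norms and powers of a self-adjoint map\<close>

text \<open>A supremum of reals bounds its members only if the set is bounded above; continuity of
  linear maps in finite dimension supplies the bound, and the quotient at \<open>0\<close> is
  \<open>0 / 0 = 0\<close>.\<close>

lemma onorm_on_bound:
  fixes f :: "'v::euclidean_space \<Rightarrow> 'v"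
  assumes "linear f" "x \<in> V"
  shows "norm (f x) \<le> onorm_on V f * norm x"
proof (cases "x = 0")
  case True
  then show ?thesis using assms by (simp add: linear_0)
next
  case False
  obtain B where B: "\<And>x. norm (f x) \<le> B * norm x" "B > 0"
    using linear_bounded_pos[OF assms(1)] by blast
  have "norm (f y) / norm y \<le> B" for y
    using B by (cases "y = 0") (auto simp: field_simps)
  then have "bdd_above ((\<lambda>x. norm (f x) / norm x) ` V)"
    by (auto intro!: bdd_aboveI[of _ B])
  then have "norm (f x) / norm x \<le> onorm_on V f"
    unfolding onorm_on_def using assms by (intro cSUP_upper) auto
  then show ?thesis using False by (simp add: field_simps)
qed

lemma onorm_on_nonneg:
  fixes f :: "'v::euclidean_space \<Rightarrow> 'v"
  assumes "linear f" "0 \<in> V"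
  shows "0 \<le> onorm_on V f"
proof (cases "V = {0}")
  case True
  then show ?thesis by (simp add: onorm_on_def)
next
  case False
  then obtain x where "x \<in> V" "x \<noteq> 0" using assms by blast
  then show ?thesis
    using onorm_on_bound[OF assms(1), of x V] 
    by (metis norm_ge_zero order_trans zero_le_mult_iff norm_le_zero_iff)
qed

lemma norm_funpow_le:
  fixes f :: "'v::euclidean_space \<Rightarrow> 'v"
  assumes "linear f" "\<And>x. x \<in> V \<Longrightarrow> f x \<in> V" "A \<in> V" "0 \<in> V"
  shows "norm ((f ^^ m) A) \<le> onorm_on V f ^ m * norm A"
proof -
  have V: "(f ^^ m) A \<in> V" for m
    by (induction m) (use assms in auto)
  show ?thesis
  proof (induction m)
    case (Suc m)
    have "norm ((f ^^ Suc m) A) \<le> onorm_on V f * norm ((f ^^ m) A)"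
      using onorm_on_bound[OF assms(1) V] by simp
    also have "\<dots> \<le> onorm_on V f * (onorm_on V f ^ m * norm A)"
      using Suc onorm_on_nonneg[OF assms(1,4)] by (intro mult_left_mono)
    finally show ?case by simp
  qed simp
qed

lemma linear_funpow: "linear f \<Longrightarrow> linear (f ^^ m)"
  for f :: "'v::real_vector \<Rightarrow> 'v"
  by (induction m) (auto intro: linear_compose simp: linear_id id_def[symmetric])

text \<open>Self-adjointness makes the complement of \<open>E\<close> inside \<open>U\<close>
  invariant. Splitting \<open>A\<close> along \<open>E\<close>, the part in \<open>E\<close> is
  scaled by exactly \<open>r\<close> at each step, while the rest shrinks at the rate of the
  restricted norm.\<close>

lemma funpow_eigen_gap:
  fixes f :: "'v::euclidean_space \<Rightarrow> 'v"
  assumes lin: "linear f" and adj: "\<And>x y. f x \<bullet> y = x \<bullet> f y"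
    and U: "subspace U" and inv: "\<And>x. x \<in> U \<Longrightarrow> f x \<in> U"
    and E: "E = {Y \<in> U. f Y = r *\<^sub>R Y}" and A: "A \<in> U"
  shows "norm ((f ^^ m) A - r ^ m *\<^sub>R orth_proj E A) \<le> onorm_on (U \<inter> E\<^sup>\<bottom>) f ^ m * norm A"
    and "subspace E"
proof -
  let ?V = "U \<inter> E\<^sup>\<bottom>" and ?Y = "orth_proj E A"
  show sE: "subspace E"
    using U unfolding E subspace_def
    by (auto simp: linear_0[OF lin] linear_add[OF lin] linear_scale[OF lin] scaleR_add_right)
  have V0: "0 \<in> ?V"
    using U by (simp add: subspace_0 subspace_orthogonal_comp)
  have Vinv: "f x \<in> ?V" if "x \<in> ?V" for x
  proof -
    have "orthogonal y (f x)" if y: "y \<in> E" for y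
    proof -
      have "y \<bullet> f x = r * (y \<bullet> x)"
        using y adj[of y x] by (simp add: E)
      also have "y \<bullet> x = 0" using \<open>x \<in> ?V\<close> y by (auto simp: orthogonal_comp_def orthogonal_def)
      finally show ?thesis by (simp add: orthogonal_def)
    qed
    then show ?thesis using inv that by (auto simp: orthogonal_comp_def)
  qed
  have YU: "?Y \<in> U" and fY: "f ?Y = r *\<^sub>R ?Y" using orth_proj(1)[OF sE, of A] by (auto simp: E)
  have "A - ?Y \<in> ?V"
    using A YU U orth_proj(2)[OF sE, of _ A]
    by (auto simp: subspace_diff orthogonal_comp_def orthogonal_commute)
  have pow: "(f ^^ m) ?Y = r ^ m *\<^sub>R ?Y"
    by (induction m) (auto simp: linear_scale[OF lin] fY)
  have "(f ^^ m) A - r ^ m *\<^sub>R ?Y = (f ^^ m) (A - ?Y)"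
    by (simp add: linear_diff[OF linear_funpow[OF lin]] pow)
  also have "norm \<dots> \<le> onorm_on ?V f ^ m * norm (A - ?Y)"
    by (rule norm_funpow_le[OF lin Vinv \<open>A - ?Y \<in> ?V\<close> V0])
  also have "\<dots> \<le> onorm_on ?V f ^ m * norm A"
    using onorm_on_nonneg[OF lin V0] norm_orth_proj_le[OF sE] by (intro mult_left_mono) auto
  finally show "norm ((f ^^ m) A - r ^ m *\<^sub>R ?Y) \<le> onorm_on ?V f ^ m * norm A" .
qed

section \<open>Null-space projectors, pseudoinverses and gradient descent\<close>

definition null_space :: "nat \<Rightarrow> (nat \<Rightarrow> real^'d::finite) \<Rightarrow> (real^'d) set" where
  "null_space n X = {v. \<forall>i<n. X i \<bullet> v = 0}"

lemma subspace_null_space: "subspace (null_space n X)"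
  unfolding subspace_def null_space_def by (simp add: inner_simps)

lemma orth_proj_self: "subspace E \<Longrightarrow> v \<in> E \<Longrightarrow> orth_proj E v = v"
  for v :: "'v::euclidean_space"
  by (rule orth_proj_unique) (auto simp: orthogonal_def)

lemma orth_proj_adjoint:
  fixes v :: "'v::euclidean_space"
  assumes "subspace E"
  shows "orth_proj E u \<bullet> v = u \<bullet> orth_proj E v"
  using orth_proj(2)[OF assms orth_proj(1)[OF assms, of u], of v]
    orth_proj(2)[OF assms orth_proj(1)[OF assms, of v], of u]
  by (simp add: orthogonal_def inner_diff_left inner_diff_right inner_commute)

lemma mat_BX_vector_mult: "mat_BX n B X *v v = (\<Sum>i<n. (X i \<bullet> v) *\<^sub>R B i)"
proof -
  have "(mat_BX n B X *v v) $ j = (\<Sum>i<n. (X i \<bullet> v) *\<^sub>R B i) $ j" for j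
    unfolding mat_BX_def matrix_vector_mult_def inner_vec_def
    by (simp add: sum_distrib_right) (subst sum.swap, simp add: mult_ac)
  then show ?thesis by (simp add: vec_eq_iff)
qed

lemma transpose_mat_BX: "transpose (mat_BX n B X) = mat_BX n X B"
  by (simp add: mat_BX_def transpose_def mult.commute)

text \<open>
  \<open>G + p\<close>, where \<open>G = X\<^sup>T X\<close> and \<open>p\<close> is the orthogonal projector onto the null space,
  is invertible, and \<open>(G + p)\<^sup>-\<^sup>1 X\<^sup>T\<close> is the pseudoinverse.
\<close>

lemma pinv_exists:
  fixes X :: "nat \<Rightarrow> real^'d::finite"
  shows "\<exists>B. is_pinv n X B \<and> (\<forall>i\<ge>n. B i = 0)"
proof -
  define p where "p = orth_proj (null_space n X)"
  define G where "G v = (\<Sum>i<n. (X i \<bullet> v) *\<^sub>R X i)" for v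
  define H where "H v = G v + p v" for v
  note sub = subspace_null_space[of n X]
  have linp: "linear p" unfolding p_def by (rule linear_orth_proj[OF sub])
  have linG: "linear G"
    by (rule linearI) (auto simp: G_def inner_simps scaleR_add_left sum.distrib scaleR_sum_right)
  have linH: "linear H" unfolding H_def by (intro linear_compose_add linG linp)
  have p_adj: "p u \<bullet> v = u \<bullet> p v" for u v
    unfolding p_def by (rule orth_proj_adjoint[OF sub])
  have G_adj: "G u \<bullet> v = u \<bullet> G v" for u v
    by (simp add: G_def inner_sum_left inner_sum_right inner_commute mult_ac)
  have pN: "p v \<in> null_space n X" for v unfolding p_def by (rule orth_proj(1)[OF sub])
  have pp: "p (p v) = p v" for v
    using orth_proj_self[OF sub pN] by (simp add: p_def)
  have Gp: "G (p v) = 0" for v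
    using pN[of v] by (simp add: G_def null_space_def)
  have pX: "p (X i) = 0" if "i < n" for i
    unfolding p_def by (rule orth_proj_unique[OF sub]) (use that sub in \<open>auto simp: null_space_def orthogonal_def\<close>)
  \<comment> \<open>Pairing \<open>H v\<close> with \<open>v\<close> gives a sum of nonnegative
    terms, so \<open>H v = 0\<close> forces both \<open>v\<close> into the null space and
    \<open>p v = 0\<close>; but \<open>p\<close> is the identity there.\<close>
  have "inj H"
  proof (subst linear_injective_0[OF linH], intro allI impI)
    fix v assume Hv: "H v = 0"
    have "0 = v \<bullet> H v" using Hv by simp
    also have "\<dots> = (\<Sum>i<n. (X i \<bullet> v)\<^sup>2) + p v \<bullet> p v"
      using p_adj[of v "p v"] pp[of v]
      by (simp add: H_def inner_add_right G_def inner_sum_right inner_commute power2_eq_square)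
    finally have "(\<Sum>i<n. (X i \<bullet> v)\<^sup>2) = 0" "p v \<bullet> p v = 0"
      using sum_nonneg[of "{..<n}" "\<lambda>i. (X i \<bullet> v)\<^sup>2"] inner_ge_zero[of "p v"]
      by (simp_all del: inner_ge_zero inner_eq_zero_iff add: add_nonneg_eq_0_iff)
    then have "v \<in> null_space n X" "p v = 0"
      by (auto simp: null_space_def sum_nonneg_eq_0_iff)
    then show "v = 0"
      using orth_proj_self[OF sub] by (simp add: p_def)
  qed
  then obtain K where K: "linear K" "\<And>v. K (H v) = v" "\<And>v. H (K v) = v"
    using linear_injective_isomorphism[OF linH] by blast
  have H_adj: "H u \<bullet> v = u \<bullet> H v" for u v
    by (simp add: H_def inner_simps G_adj p_adj)
  have K_adj: "K u \<bullet> v = u \<bullet> K v" for u v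
    using H_adj[of "K u" "K v"] by (simp add: K)
  \<comment> \<open>\<open>H\<close> is the identity on the null space, hence so is its inverse
    \<open>K\<close>; taking adjoints turns \<open>K p = p\<close> into
    \<open>p K = p\<close>.\<close>
  have "H (p v) = p v" for v by (simp add: H_def Gp pp)
  then have Kp: "K (p v) = p v" for v by (metis K(2))
  have pK: "p (K v) = p v" for v
  proof -
    have "p (K v) \<bullet> u = p v \<bullet> u" for u by (simp add: p_adj K_adj Kp)
    then show ?thesis by (metis vector_eq_rdot)
  qed
  \<comment> \<open>Both products of \<open>K\<close> and \<open>G\<close> are \<open>I - p\<close>,
    the projector onto the row space; the Penrose equations reduce to this and to
    \<open>p (X i) = 0\<close>.\<close>
  have KG: "K (G v) = v - p v" for v
    using K(2)[of v] by (simp add: H_def linear_add[OF K(1)] Kp algebra_simps)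
  have GK: "G (K v) = v - p v" for v
    using K(3)[of v] by (simp add: H_def pK algebra_simps)
  define B where "B i = (if i < n then K (X i) else 0)" for i
  have KGs: "(\<Sum>m<n. (X m \<bullet> v) *\<^sub>R B m) = v - p v" for v
    using KG[of v] by (simp add: G_def B_def linear_sum[OF K(1)] linear_scale[OF K(1)])
  have "(\<Sum>m<n. (X i \<bullet> B m) *\<^sub>R X m) = X i" if "i < n" for i
  proof -
    have "(\<Sum>m<n. (X i \<bullet> B m) *\<^sub>R X m) = (\<Sum>m<n. (X m \<bullet> K (X i)) *\<^sub>R X m)"
      using K_adj[of "X i"] by (intro sum.cong) (simp_all add: B_def inner_commute)
    then show ?thesis using GK[of "X i"] pX[OF that] by (simp add: G_def)
  qed
  moreover have "(\<Sum>m<n. (X m \<bullet> B i) *\<^sub>R B m) = B i" if "i < n" for i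
    using pX[OF that] that by (simp add: KGs) (simp add: B_def pK)
  moreover have "X i \<bullet> B m = X m \<bullet> B i" if "i < n" "m < n" for i m
    using that K_adj[of "X i" "X m"] by (simp add: B_def inner_commute)
  moreover have "transpose (mat_BX n B X) = mat_BX n B X"
  proof -
    have "(\<Sum>i<n. (B i \<bullet> v) *\<^sub>R X i) = v - p v" for v
      using GK[of v] by (simp add: G_def B_def K_adj)
    then show ?thesis
      by (simp add: transpose_mat_BX matrix_eq mat_BX_vector_mult KGs)
  qed
  ultimately show ?thesis
    by (intro exI[of _ B]) (auto simp: is_pinv_def B_def)
qed

lemma is_pinvD:
  assumes "is_pinv n X B" "i < n"
  shows "(\<Sum>m<n. (X i \<bullet> B m) *\<^sub>R X m) = X i"
    and "(\<Sum>m<n. (X m \<bullet> B i) *\<^sub>R B m) = B i"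
    and "m < n \<Longrightarrow> X i \<bullet> B m = X m \<bullet> B i"
  using assms unfolding is_pinv_def by blast+

lemma is_pinv_symmetric_mult:
  assumes "is_pinv n X B"
  shows "(\<Sum>m<n. (X m \<bullet> v) *\<^sub>R B m) = (\<Sum>m<n. (B m \<bullet> v) *\<^sub>R X m)"
  using assms mat_BX_vector_mult[of n B X v] mat_BX_vector_mult[of n X B v]
  by (simp add: is_pinv_def transpose_mat_BX)

text \<open>The second and fourth Penrose equations put the columns of any pseudoinverse in the row
  space of \<open>X\<close>; the first and third fix their inner products with every row. The
  difference of two candidates thus lies in the row space and is orthogonal to it.\<close>

lemma is_pinv_unique:
  assumes B: "is_pinv n X B" and C: "is_pinv n X C" and i: "i < n"
  shows "B i = C i"
proof -
  have span: "D i \<in> span (X ` {..<n})" if D: "is_pinv n X D" for D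
  proof -
    have "D i = (\<Sum>m<n. (D m \<bullet> D i) *\<^sub>R X m)"
      using is_pinvD(2)[OF D i] is_pinv_symmetric_mult[OF D, of "D i"] by simp
    also have "\<dots> \<in> span (X ` {..<n})"
      by (intro span_sum span_scale span_base) auto
    finally show ?thesis .
  qed
  have "X j \<bullet> B i = X j \<bullet> C i" if j: "j < n" for j
  proof -
    have "X j \<bullet> B i = (\<Sum>m<n. (X j \<bullet> C m) *\<^sub>R X m) \<bullet> B i"
      by (simp only: is_pinvD(1)[OF C j])
    also have "\<dots> = (\<Sum>m<n. (X m \<bullet> C j) * (X i \<bullet> B m))"
      unfolding inner_sum_left inner_scaleR_left
      by (intro sum.cong refl arg_cong2[of _ _ _ _ "(*)"] is_pinvD(3)[OF C j] is_pinvD(3)[OF B _ i]) auto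
    also have "\<dots> = (\<Sum>m<n. (X i \<bullet> B m) *\<^sub>R X m) \<bullet> C j"
      by (simp add: inner_sum_left mult.commute)
    also have "\<dots> = X i \<bullet> C j" by (simp only: is_pinvD(1)[OF B i])
    also have "\<dots> = X j \<bullet> C i" by (rule is_pinvD(3)[OF C i j])
    finally show ?thesis .
  qed
  then have "orthogonal (B i - C i) x" if "x \<in> X ` {..<n}" for x
    using that by (auto simp: orthogonal_def inner_commute[of "_ - _"] inner_diff_right)
  then have "orthogonal (B i - C i) (B i - C i)"
    using span[OF B] span[OF C] orthogonal_to_span span_diff by blast
  then show ?thesis by (simp add: orthogonal_self)
qed

lemma is_pinv_pinv: "is_pinv n X (pinv n X)"
proof -
  have "\<exists>!B. is_pinv n X B \<and> (\<forall>i\<ge>n. B i = 0)"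
  proof (rule ex_ex1I[OF pinv_exists])
    fix B C assume "is_pinv n X B \<and> (\<forall>i\<ge>n. B i = 0)" "is_pinv n X C \<and> (\<forall>i\<ge>n. C i = 0)"
    then show "B = C" using is_pinv_unique[of n X B C] by (metis ext not_le)
  qed
  from theI'[OF this] show ?thesis by (simp add: pinv_def)
qed

section \<open>The null-space projector and the exact-fit update\<close>

text \<open>\<open>X X\<^sup>+ X = X\<close> places \<open>P v\<close> in the null space, and
  symmetry of \<open>X\<^sup>+ X\<close> writes \<open>v - P v\<close> as a combination of rows,
  orthogonal to the null space.\<close>

lemma nullproj_vector_mult:
  "nullproj \<tau> *v v = orth_proj (null_space (nrows \<tau>) (dataX \<tau>)) v"
proof -
  define n X B where "n = nrows \<tau>" and "X = dataX \<tau>" and "B = pinv n X"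
  have B: "is_pinv n X B" by (simp add: B_def is_pinv_pinv)
  have P: "nullproj \<tau> *v v = v - (\<Sum>m<n. (X m \<bullet> v) *\<^sub>R B m)" for v
    by (simp add: nullproj_def n_def X_def B_def matrix_vector_mult_diff_rdistrib mat_BX_vector_mult)
  have "orth_proj (null_space n X) v = nullproj \<tau> *v v"
  proof (rule orth_proj_unique[OF subspace_null_space])
    have "X i \<bullet> (\<Sum>m<n. (X m \<bullet> v) *\<^sub>R B m) = X i \<bullet> v" if "i < n" for i
    proof -
      have "X i \<bullet> (\<Sum>m<n. (X m \<bullet> v) *\<^sub>R B m) = (\<Sum>m<n. (X i \<bullet> B m) *\<^sub>R X m) \<bullet> v"
        by (simp add: inner_sum_left inner_sum_right mult.commute)
      then show ?thesis by (simp only: is_pinvD(1)[OF B that])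
    qed
    then show "nullproj \<tau> *v v \<in> null_space n X"
      by (simp add: P null_space_def inner_diff_right)
    fix z assume z: "z \<in> null_space n X"
    have "(\<Sum>m<n. (B m \<bullet> v) *\<^sub>R X m) \<bullet> z = 0"
      using z by (simp add: inner_sum_left null_space_def)
    then show "orthogonal (v - nullproj \<tau> *v v) z"
      by (simp add: P orthogonal_def is_pinv_symmetric_mult[OF B])
  qed
  then show ?thesis by (simp add: n_def X_def)
qed

lemma transpose_nullproj [simp]: "transpose (nullproj \<tau>) = nullproj \<tau>"
  using is_pinv_pinv[of "nrows \<tau>" "dataX \<tau>"]
  by (simp add: nullproj_def is_pinv_def transpose_def vec_eq_iff mat_def)

lemma nullproj_idem [simp]: "nullproj \<tau> ** nullproj \<tau> = nullproj \<tau>"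
  by (simp add: matrix_eq matrix_vector_mul_assoc[symmetric] nullproj_vector_mult
      orth_proj_self orth_proj(1) subspace_null_space)

lemma fits_diff_null_space:
  assumes "fits \<tau> u"
  shows "fits \<tau> z \<longleftrightarrow> z - u \<in> null_space (nrows \<tau>) (dataX \<tau>)"
  using assms by (auto simp: fits_def null_space_def inner_diff_right)

text \<open>The claimed value is the projection of \<open>v\<close> onto the affine solution set,
  and Pythagoras splits the distance from \<open>v\<close> to any solution. For \<open>u\<close> the
  common solution this is the recursion
  \<open>e\<^sub>t = P\<^sub>t e\<^sub>t\<^sub>-\<^sub>1\<close>.\<close>

lemma arg_min_fits:
  assumes u: "fits \<tau> u"
  shows "arg_min (\<lambda>w. 1/2 * (norm (w - v))\<^sup>2) (fits \<tau>) = u + nullproj \<tau> *v (v - u)"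
proof -
  define N where "N = null_space (nrows \<tau>) (dataX \<tau>)"
  have sN: "subspace N" by (simp add: N_def subspace_null_space)
  define z where "z = u + orth_proj N (v - u)"
  have fz: "fits \<tau> z"
    using fits_diff_null_space[OF u, of z] orth_proj(1)[OF sN] by (simp add: z_def N_def)
  have pyth: "(norm (x - v))\<^sup>2 = (norm (x - z))\<^sup>2 + (norm (z - v))\<^sup>2" if "fits \<tau> x" for x
  proof -
    have "x - z \<in> N" using that fits_diff_null_space[OF fz] by (simp add: N_def)
    then have "orthogonal ((v - u) - orth_proj N (v - u)) (x - z)"
      by (rule orth_proj(2)[OF sN])
    moreover have "z - v = - ((v - u) - orth_proj N (v - u))"
      by (simp add: z_def)
    ultimately have "orthogonal (x - z) (z - v)"
      by (simp only: orthogonal_def inner_minus_right inner_commute)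
    from norm_add_Pythagorean[OF this] show ?thesis by simp
  qed
  \<comment> \<open>\<open>arg_min\<close> chooses some minimiser, so its value is known only once
    the minimiser is shown to be unique.\<close>
  have "is_arg_min (\<lambda>w. 1/2 * (norm (w - v))\<^sup>2) (fits \<tau>) x \<longleftrightarrow> x = z" for x
  proof
    assume "is_arg_min (\<lambda>w. 1/2 * (norm (w - v))\<^sup>2) (fits \<tau>) x"
    then have "fits \<tau> x" "(norm (x - v))\<^sup>2 \<le> (norm (z - v))\<^sup>2"
      using fz by (auto simp: is_arg_min_def not_less)
    then show "x = z" using pyth[of x] by auto
  next
    have "(norm (z - v))\<^sup>2 \<le> (norm (y - v))\<^sup>2" if "fits \<tau> y" for y
      using pyth[OF that] by simp
    moreover assume "x = z"
    ultimately show "is_arg_min (\<lambda>w. 1/2 * (norm (w - v))\<^sup>2) (fits \<tau>) x"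
      using fz by (fastforce simp: is_arg_min_def not_less)
  qed
  then show ?thesis
    by (simp add: arg_min_def z_def N_def nullproj_vector_mult)
qed

text \<open>
  Gradient descent on \<open>X v = y\<close> with step size \<open>1 / (1 + tr (X\<^sup>T X))\<close> converges to the solution nearest
  to the starting point. It exhibits null-space projectors and iterates as limits of
  explicit functions of the task, which is how their measurability is obtained.
\<close>

definition gd_step :: "nat \<Rightarrow> (nat \<Rightarrow> real^'d::finite) \<Rightarrow> (nat \<Rightarrow> real) \<Rightarrow> real^'d \<Rightarrow> real^'d" where
  "gd_step n X y v =
     v + (1 / (1 + (\<Sum>i<n. (norm (X i))\<^sup>2))) *\<^sub>R (\<Sum>i<n. (y i - X i \<bullet> v) *\<^sub>R X i)"

text \<open>With step size \<open>t\<close>, expanding the square yields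
  \<open>- 2 t q + t^2 |g|^2\<close>, and Cauchy-Schwarz gives \<open>|g|^2 \<le> s q\<close>. The
  choice \<open>t = 1 / (1 + s)\<close> makes the second term at most \<open>t q\<close>; the
  summand \<open>1\<close> keeps it defined when all rows vanish.\<close>

lemma gd_step_contracts:
  "(norm (gd_step n X (\<lambda>_. 0) v))\<^sup>2
     \<le> (norm v)\<^sup>2 - (\<Sum>i<n. (X i \<bullet> v)\<^sup>2) / (1 + (\<Sum>i<n. (norm (X i))\<^sup>2))"
proof -
  define s where "s = (\<Sum>i<n. (norm (X i))\<^sup>2)"
  define q where "q = (\<Sum>i<n. (X i \<bullet> v)\<^sup>2)"
  define g where "g = (\<Sum>i<n. (X i \<bullet> v) *\<^sub>R X i)"
  have s: "s \<ge> 0" and q: "q \<ge> 0" by (auto simp: s_def q_def sum_nonneg)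
  have "gd_step n X (\<lambda>_. 0) v = v - (1 / (1 + s)) *\<^sub>R g"
    by (simp add: gd_step_def s_def g_def sum_negf)
  moreover have "(norm (v - t *\<^sub>R g))\<^sup>2 = (norm v)\<^sup>2 - 2 * t * (v \<bullet> g) + t\<^sup>2 * (norm g)\<^sup>2" for t
    unfolding power2_norm_eq_inner by (simp add: inner_simps inner_commute[of g v])
      (simp add: power2_eq_square algebra_simps)
  moreover have "v \<bullet> g = q"
    by (simp add: g_def q_def inner_sum_right power2_eq_square inner_commute)
  moreover have "(norm g)\<^sup>2 \<le> s * q"
  proof -
    have "norm g \<le> (\<Sum>i<n. \<bar>X i \<bullet> v\<bar> * norm (X i))"
      unfolding g_def by (rule sum_norm_le) simp
    then have "(norm g)\<^sup>2 \<le> (\<Sum>i<n. \<bar>X i \<bullet> v\<bar> * norm (X i))\<^sup>2"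
      by (intro power_mono) auto
    also have "\<dots> \<le> q * s"
      using Cauchy_Schwarz_ineq_sum[of "\<lambda>i. \<bar>X i \<bullet> v\<bar>" "\<lambda>i. norm (X i)" "{..<n}"]
      by (simp add: q_def s_def)
    finally show ?thesis by (simp add: mult.commute)
  qed
  moreover have "(1 / (1 + s))\<^sup>2 * (s * q) \<le> q / (1 + s)"
  proof -
    have "(1 / (1 + s))\<^sup>2 * (s * q) = (q / (1 + s)) * (s / (1 + s))"
      by (simp add: power2_eq_square)
    also have "\<dots> \<le> (q / (1 + s)) * 1"
      using s q by (intro mult_left_mono) auto
    finally show ?thesis by simp
  qed
  ultimately show ?thesis
    using mult_left_mono[of "(norm g)\<^sup>2" "s * q" "(1 / (1 + s))\<^sup>2"]
    by (simp add: s_def[symmetric] q_def[symmetric])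
qed

text \<open>Recentring at a solution \<open>u\<close> removes \<open>y\<close> and leaves powers of
  a linear map \<open>f\<close>. The null-space component \<open>z\<close> is fixed by
  \<open>f\<close>, and the component \<open>r\<close> orthogonal to it decays
  geometrically.\<close>

lemma tendsto_gd_step:
  assumes u: "\<And>i. i < n \<Longrightarrow> X i \<bullet> u = y i"
  shows "(\<lambda>m. (gd_step n X y ^^ m) v) \<longlonglongrightarrow> u + orth_proj (null_space n X) (v - u)"
proof -
  define N where "N = null_space n X"
  define f where "f = gd_step n X (\<lambda>_. 0)"
  have sN: "subspace N" by (simp add: N_def subspace_null_space)
  have linf: "linear f"
  proof -
    have "linear (\<lambda>v. (0 - X i \<bullet> v) *\<^sub>R X i)" for i
      by (rule linearI) (auto simp: inner_add_right scaleR_add_left scaleR_diff_left)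
    then have "linear (\<lambda>v. \<Sum>i<n. (0 - X i \<bullet> v) *\<^sub>R X i)"
      by (intro linear_compose_sum) auto
    then show ?thesis
      unfolding f_def gd_step_def
      by (intro linear_compose_add linear_ident linear_compose_scale_right)
  qed
  define z where "z = orth_proj N (v - u)"
  define r where "r = v - u - z"
  have shift: "(gd_step n X y ^^ m) v = u + (f ^^ m) (v - u)" for m
  proof (induction m)
    case (Suc m)
    have "gd_step n X y (u + w) = u + f w" for w
      using u by (simp add: gd_step_def f_def inner_add_right algebra_simps)
    with Suc show ?case by simp
  qed simp
  have "f z = z"
    using orth_proj(1)[OF sN, of "v - u"] by (simp add: z_def f_def gd_step_def N_def null_space_def)
  then have fz: "(f ^^ m) z = z" for m by (induction m) auto
  define R where "R = N\<^sup>\<bottom>"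
  have sR: "subspace R" by (simp add: R_def subspace_orthogonal_comp)
  have rR: "r \<in> R"
    using orth_proj(2)[OF sN, of _ "v - u"]
    by (auto simp: R_def r_def z_def orthogonal_comp_def orthogonal_commute)
  have X_R: "X i \<in> R" if "i < n" for i
    using that by (auto simp: R_def orthogonal_comp_def N_def null_space_def orthogonal_def inner_commute)
  have fR: "f x \<in> R" if "x \<in> R" for x
    unfolding f_def gd_step_def using that X_R sR
    by (auto intro!: subspace_add subspace_scale subspace_sum subspace_neg)
  \<comment> \<open>A nonzero vector orthogonal to the null space is detected by some row, so the
    decrease in \<open>gd_step_contracts\<close> is positive.\<close>
  have strict: "norm (f x) < norm x" if "x \<in> R" "x \<noteq> 0" for x
  proof -
    have "x \<notin> N" using that by (auto simp: R_def orthogonal_comp_def orthogonal_self)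
    then obtain i where i: "i < n" "X i \<bullet> x \<noteq> 0" by (auto simp: N_def null_space_def)
    then have "(\<Sum>i<n. (X i \<bullet> x)\<^sup>2) > 0"
      by (intro sum_pos2[of _ i]) auto
    moreover have "1 + (\<Sum>i<n. (norm (X i))\<^sup>2) > 0"
      by (simp add: add_pos_nonneg sum_nonneg)
    ultimately have "(norm (f x))\<^sup>2 < (norm x)\<^sup>2"
      using gd_step_contracts[of n X x] by (simp add: f_def) (smt (verit) divide_pos_pos)
    then show ?thesis by (simp add: power2_less_imp_less)
  qed
  \<comment> \<open>Compactness of the unit sphere of \<open>R\<close> upgrades strict decrease to a
    uniform factor below 1. If the sphere is empty, \<open>R\<close> is trivial and
    \<open>c = 0\<close> works.\<close>
  obtain c where c: "0 \<le> c" "c < 1" "\<And>x. x \<in> R \<Longrightarrow> norm (f x) \<le> c * norm x"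
  proof (cases "R \<inter> sphere 0 1 = {}")
    case True
    have "x = 0" if "x \<in> R" for x
    proof (rule ccontr)
      assume "x \<noteq> 0"
      then have "(1 / norm x) *\<^sub>R x \<in> R \<inter> sphere 0 1"
        using that sR by (auto simp: subspace_scale)
      with True show False by blast
    qed
    then have "x \<in> R \<Longrightarrow> norm (f x) \<le> 0 * norm x" for x using linear_0[OF linf] by fastforce
    then show thesis using that[of 0] by simp
  next
    case False
    have "compact (R \<inter> sphere 0 1)"
      using closed_subspace[OF sR] by (simp add: closed_Int_compact)
    moreover have "continuous_on (R \<inter> sphere 0 1) (\<lambda>x. norm (f x))"
      using linf by (intro continuous_on_norm linear_continuous_on) (simp add: linear_conv_bounded_linear)
    ultimately obtain x where x: "x \<in> R \<inter> sphere 0 1"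
      and mx: "\<And>y. y \<in> R \<inter> sphere 0 1 \<Longrightarrow> norm (f y) \<le> norm (f x)"
      using continuous_attains_sup[OF _ False] by blast
    have "norm (f y) \<le> norm (f x) * norm y" if y: "y \<in> R" for y
    proof (cases "y = 0")
      case True
      then show ?thesis by (simp add: linear_0[OF linf])
    next
      case False
      then have "norm (f ((1 / norm y) *\<^sub>R y)) \<le> norm (f x)"
        using y sR by (intro mx) (auto simp: subspace_scale)
      then show ?thesis using False by (simp add: linear_scale[OF linf] field_simps)
    qed
    moreover have "norm (f x) < 1"
    proof -
      have "x \<in> R" "norm x = 1" using x by auto
      moreover from \<open>norm x = 1\<close> have "x \<noteq> 0" by force
      ultimately show ?thesis using strict[of x] by simp
    qed
    ultimately show thesis using that[of "norm (f x)"] by simp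
  qed
  have pow: "norm ((f ^^ m) r) \<le> c ^ m * norm r \<and> (f ^^ m) r \<in> R" for m
  proof (induction m)
    case (Suc m)
    have "norm (f ((f ^^ m) r)) \<le> c * norm ((f ^^ m) r)"
      using Suc c(3) by blast
    also have "\<dots> \<le> c * (c ^ m * norm r)"
      using Suc c(1) by (intro mult_left_mono) auto
    finally show ?case using Suc fR by simp
  qed (simp add: rR)
  have "(\<lambda>m. c ^ m * norm r) \<longlonglongrightarrow> 0"
    using c by (intro tendsto_mult_left_zero LIMSEQ_power_zero) auto
  then have "(\<lambda>m. (f ^^ m) r) \<longlonglongrightarrow> 0"
    by (rule Lim_null_comparison[rotated]) (simp add: pow)
  then have "(\<lambda>m. u + (z + (f ^^ m) r)) \<longlonglongrightarrow> u + (z + 0)"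
    by (intro tendsto_intros)
  moreover have "(f ^^ m) (v - u) = z + (f ^^ m) r" for m
    using linear_add[OF linear_funpow[OF linf], of m z r] by (simp add: fz r_def)
  ultimately show ?thesis by (simp add: shift z_def N_def)
qed

section \<open>Measurability\<close>

lemma measurable_nrows: "nrows \<in> task_space \<rightarrow>\<^sub>M count_space UNIV"
proof -
  have "nrows \<in> borel_measurable (borel :: 'd::finite task measure)"
    unfolding nrows_def by (intro borel_measurable_continuous_onI continuous_intros)
  then show ?thesis
    unfolding task_space_def
    by (intro measurable_restrict_space1)
       (simp add: measurable_cong_sets[OF refl sets_borel_eq_count_space])
qed

lemma measurable_dataX: "(\<lambda>\<tau>. dataX \<tau> i) \<in> borel_measurable task_space"
  unfolding dataX_def task_space_def
  by (rule measurable_restrict_space1, rule borel_measurable_continuous_onI,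
      rule continuous_on_product_then_coordinatewise, intro continuous_intros)

lemma measurable_datay: "(\<lambda>\<tau>. datay \<tau> i) \<in> borel_measurable task_space"
  unfolding datay_def task_space_def
  by (rule measurable_restrict_space1, rule borel_measurable_continuous_onI,
      rule continuous_on_product_then_coordinatewise, intro continuous_intros)

text \<open>The number of summands varies with the point; it takes countably many values, so it can
  be frozen at each of them.\<close>

lemma measurable_gd_step:
  assumes "n \<in> N \<rightarrow>\<^sub>M count_space UNIV" "\<And>i. (\<lambda>x. X x i) \<in> borel_measurable N"
    "\<And>i. (\<lambda>x. y x i) \<in> borel_measurable N" "v \<in> borel_measurable N"
  shows "(\<lambda>x. gd_step (n x) (X x) (y x) (v x)) \<in> borel_measurable N"
proof (rule measurable_compose_countable[OF _ assms(1)])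
  note [measurable] = assms
  show "(\<lambda>x. gd_step i (X x) (y x) (v x)) \<in> borel_measurable N" for i
    unfolding gd_step_def by measurable
qed

lemma measurable_lim_gd_step:
  assumes "n \<in> N \<rightarrow>\<^sub>M count_space UNIV" "\<And>i. (\<lambda>x. X x i) \<in> borel_measurable N"
    "\<And>i. (\<lambda>x. y x i) \<in> borel_measurable N" "v \<in> borel_measurable N"
  shows "(\<lambda>x. lim (\<lambda>m. (gd_step (n x) (X x) (y x) ^^ m) (v x))) \<in> borel_measurable N"
proof (rule borel_measurable_lim_metric)
  show "(\<lambda>x. (gd_step (n x) (X x) (y x) ^^ m) (v x)) \<in> borel_measurable N" for m
    by (induction m) (simp_all add: assms measurable_gd_step)
qed

text \<open>\<open>pinv\<close> is a definite description, with no formula to inspect. Gradient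
  descent for \<open>y = 0\<close>, started at the basis vectors, converges to the columns of the
  projector instead.\<close>

lemma measurable_nullproj:
  "(nullproj :: 'd::finite task \<Rightarrow> _) \<in> borel_measurable task_space"
proof -
  define c where "c j \<tau> = lim (\<lambda>m. (gd_step (nrows \<tau>) (dataX \<tau>) (\<lambda>_. 0) ^^ m) (axis j 1))"
    for j and \<tau> :: "'d task"
  have c: "c j \<tau> = nullproj \<tau> *v axis j 1" for j \<tau>
    using tendsto_gd_step[of "nrows \<tau>" "dataX \<tau>" 0 "\<lambda>_. 0" "axis j 1"]
    by (auto simp: c_def nullproj_vector_mult intro!: limI)
  have eq: "nullproj = (\<lambda>\<tau> :: 'd task. \<chi> i j. c j \<tau> $ i)"
    by (simp add: fun_eq_iff c vec_eq_iff matrix_vector_mult_basis column_def)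
  have "c j \<in> borel_measurable task_space" for j
    unfolding c_def
    by (intro measurable_lim_gd_step measurable_nrows measurable_dataX) auto
  then show ?thesis
    unfolding eq by (intro borel_measurable_vec_lambda measurable_compose[OF _ borel_measurable_nth])
qed

text \<open>The common solution will be available only almost everywhere, so infeasible systems must
  be covered too. A system is solvable exactly when the limit \<open>L x\<close> solves it, which
  turns feasibility into a measurable test.\<close>

lemma arg_min_fits_measurable:
  assumes T: "T \<in> N \<rightarrow>\<^sub>M task_space" and v: "v \<in> borel_measurable N"
  shows "(\<lambda>x. arg_min (\<lambda>w. 1/2 * (norm (w - v x))\<^sup>2) (fits (T x))) \<in> borel_measurable N"
proof -
  note [measurable] = measurable_compose[OF T measurable_nrows]
    measurable_compose[OF T measurable_dataX] measurable_compose[OF T measurable_datay] v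
  define L where "L x = lim (\<lambda>m. (gd_step (nrows (T x)) (dataX (T x)) (datay (T x)) ^^ m) (v x))"
    for x
  have [measurable]: "L \<in> borel_measurable N"
    unfolding L_def by (intro measurable_lim_gd_step) measurable
  have "arg_min (\<lambda>w. 1/2 * (norm (w - v x))\<^sup>2) (fits (T x))
      = (if fits (T x) (L x) then L x else (SOME x. False))" for x
  proof (cases "\<exists>u. fits (T x) u")
    case True
    then obtain u where u: "fits (T x) u" by blast
    have L: "L x = u + nullproj (T x) *v (v x - u)"
      unfolding L_def nullproj_vector_mult
      using u by (intro limI tendsto_gd_step) (simp add: fits_def)
    have "fits (T x) (L x)"
      using fits_diff_null_space[OF u, of "L x"] orth_proj(1)[OF subspace_null_space]
      by (simp add: L nullproj_vector_mult)
    then show ?thesis by (simp only: arg_min_fits[OF u] L if_True)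
  next
    case False
    \<comment> \<open>For an infeasible system \<open>arg_min\<close> is a choice from the empty predicate, hence the same vector for all \<open>x\<close>.\<close>
    then show ?thesis by (simp add: arg_min_def is_arg_min_def)
  qed
  moreover have "(\<lambda>x. if fits (T x) (L x) then L x else (SOME x. False)) \<in> borel_measurable N"
    unfolding fits_def by measurable
  ultimately show ?thesis by simp
qed

lemma measurable_iterate:
  assumes T: "\<And>t. t \<ge> 1 \<Longrightarrow> T t \<in> N \<rightarrow>\<^sub>M task_space"
  shows "(\<lambda>x. iterate (\<lambda>t. T t x) k) \<in> borel_measurable N"
  by (induction k) (simp_all add: arg_min_fits_measurable[OF T, simplified])

lemma measurable_loss:
  assumes T: "T \<in> N \<rightarrow>\<^sub>M task_space" and v: "v \<in> borel_measurable N"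
  shows "(\<lambda>x. loss (T x) (v x)) \<in> borel_measurable N"
proof -
  note [measurable] = measurable_compose[OF T measurable_nrows]
    measurable_compose[OF T measurable_dataX] measurable_compose[OF T measurable_datay] v
  have "(\<lambda>x. (1 / real n) * (\<Sum>i<n. (dataX (T x) i \<bullet> v x - datay (T x) i)\<^sup>2))
      \<in> borel_measurable N" for n
    by measurable
  then show ?thesis
    unfolding loss_def
    by (rule measurable_compose_countable) (rule measurable_compose[OF T measurable_nrows])
qed

text \<open>Exact fit turns the residual into \<open>X (v - u)\<close>. The result is linear in the
  error matrix, so that expectations can be taken through \<open>S_op D\<close>.\<close>

lemma loss_eq_inner_covmat:
  assumes "fits \<tau> u"
  shows "loss \<tau> v = covmat \<tau> \<bullet> outer (v - u)"
proof -
  define n X where "n = nrows \<tau>" and "X = dataX \<tau>"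
  define e where "e = v - u"
  have "loss \<tau> v = (1 / real n) * (\<Sum>i<n. (X i \<bullet> e)\<^sup>2)"
    using assms by (simp add: loss_def fits_def n_def X_def e_def inner_diff_right)
  also have "(\<Sum>i<n. (X i \<bullet> e)\<^sup>2) = (\<Sum>i<n. (X i \<bullet> e) *\<^sub>R X i) \<bullet> e"
    by (simp add: inner_sum_left power2_eq_square)
  also have "\<dots> = (mat_BX n X X *v e) \<bullet> e"
    by (simp add: mat_BX_vector_mult)
  also have "\<dots> = mat_BX n X X \<bullet> outer e"
    by (simp add: inner_vec_def matrix_vector_mult_def outer_def sum_distrib_right
        sum_distrib_left mult_ac)
  finally show ?thesis by (simp add: covmat_def n_def X_def e_def)
qed

section \<open>Moments of the error\<close>

locale task_distribution = prob_space D for D :: "'d::finite task measure" +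
  assumes sets_D: "sets D = sets task_space"
begin

lemma measurable_D: "measurable D N = measurable task_space N"
  by (rule measurable_cong_sets[OF sets_D refl])

lemma nullproj_measurable [measurable]: "nullproj \<in> borel_measurable D"
  by (simp add: measurable_D measurable_nullproj)

lemma integrable_inner_compress:
  assumes A: "integrable D A" and B: "B \<in> borel_measurable D" and bd: "\<And>\<tau>. norm (B \<tau>) \<le> b"
  shows "integrable D (\<lambda>\<tau>. A \<tau> \<bullet> (nullproj \<tau> ** B \<tau> ** nullproj \<tau>))"
proof (rule Bochner_Integration.integrable_bound)
  show "integrable D (\<lambda>\<tau>. norm (A \<tau>) * b)"
    using A by simp
  show "(\<lambda>\<tau>. A \<tau> \<bullet> (nullproj \<tau> ** B \<tau> ** nullproj \<tau>)) \<in> borel_measurable D"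
    using A B by measurable
  have "norm (A \<tau> \<bullet> (nullproj \<tau> ** B \<tau> ** nullproj \<tau>)) \<le> norm (norm (A \<tau>) * b)" for \<tau>
  proof -
    have "norm (nullproj \<tau> ** B \<tau> ** nullproj \<tau>) \<le> b"
      using norm_compress_le[of "nullproj \<tau>" "B \<tau>"] bd[of \<tau>] by simp
    then have "norm (A \<tau> \<bullet> (nullproj \<tau> ** B \<tau> ** nullproj \<tau>)) \<le> norm (A \<tau>) * b"
      using Cauchy_Schwarz_ineq2[of "A \<tau>"] by (smt (verit) mult_left_mono norm_ge_zero real_norm_def)
    then show ?thesis by simp
  qed
  then show "AE \<tau> in D. norm (A \<tau> \<bullet> (nullproj \<tau> ** B \<tau> ** nullproj \<tau>)) \<le> norm (norm (A \<tau>) * b)"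
    by simp
qed

lemma integrable_compress:
  assumes "integrable D A"
  shows "integrable D (\<lambda>\<tau>. nullproj \<tau> ** A \<tau> ** nullproj \<tau>)"
  using assms
  by (rule Bochner_Integration.integrable_bound)
     (use assms in \<open>auto intro!: norm_compress_le\<close>)

text \<open>Serves both constant \<open>A\<close>, where the left integral is
  \<open>S_op D A\<close>, and the task-dependent weight met when the task being scored is
  integrated out.\<close>

lemma inner_integral_compress:
  assumes "integrable D A"
  shows "(\<integral>\<tau>. nullproj \<tau> ** A \<tau> ** nullproj \<tau> \<partial>D) \<bullet> U = (\<integral>\<tau>. A \<tau> \<bullet> (nullproj \<tau> ** U ** nullproj \<tau>) \<partial>D)"
  using integrable_compress[OF assms]
  by (simp flip: integral_inner_left add: inner_compress)

lemma linear_S_op: "linear (S_op D)"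
proof (rule linearI)
  note int = integrable_compress[OF integrable_const]
  show "S_op D (A + B) = S_op D A + S_op D B" for A B
    unfolding S_op_def linear_add[OF linear_compress] by (intro Bochner_Integration.integral_add int)
  show "S_op D (c *\<^sub>R A) = c *\<^sub>R S_op D A" for c A
    unfolding S_op_def linear_scale[OF linear_compress] by simp
qed

lemma S_op_adjoint: "S_op D A \<bullet> B = A \<bullet> S_op D B"
proof -
  have "S_op D A \<bullet> B = (\<integral>\<tau>. A \<bullet> (nullproj \<tau> ** B ** nullproj \<tau>) \<partial>D)"
    unfolding S_op_def by (rule inner_integral_compress) simp
  also have "\<dots> = A \<bullet> S_op D B"
    unfolding S_op_def by (simp add: integrable_compress)
  finally show ?thesis .
qed

lemma S_op_Sym:
  assumes "A \<in> Sym"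
  shows "S_op D A \<in> Sym"
proof -
  have "linear (transpose :: real^'d^'d \<Rightarrow> _)"
    by (rule linearI) (auto simp: transpose_def vec_eq_iff)
  then have "bounded_linear (transpose :: real^'d^'d \<Rightarrow> _)"
    by (simp add: linear_conv_bounded_linear)
  then have "transpose (S_op D A) = (\<integral>\<tau>. transpose (nullproj \<tau> ** A ** nullproj \<tau>) \<partial>D)"
    unfolding S_op_def by (subst integral_bounded_linear) (auto intro: integrable_compress)
  also have "\<dots> = S_op D A"
    using assms by (simp add: S_op_def Sym_def matrix_transpose_mul matrix_mul_assoc)
  finally show ?thesis by (simp add: Sym_def)
qed

lemma bounded_linear_funpow_S_op: "bounded_linear (S_op D ^^ m)"
  by (simp add: linear_conv_bounded_linear[symmetric] linear_funpow linear_S_op)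

end

text \<open>Started at \<open>Z = w\<^sup>* w\<^sup>*\<^sup>T\<close>, this is \<open>e\<^sub>k e\<^sub>k\<^sup>T\<close> for the error \<open>e\<^sub>k = w\<^sub>k - w\<^sup>*\<close>.\<close>

primrec error_moment ::
  "real^'d::finite^'d \<Rightarrow> (nat \<Rightarrow> 'd task) \<Rightarrow> nat \<Rightarrow> real^'d^'d" where
  "error_moment Z T 0 = Z"
| "error_moment Z T (Suc k) = nullproj (T (Suc k)) ** error_moment Z T k ** nullproj (T (Suc k))"

lemma error_moment_cong:
  "(\<And>t. 1 \<le> t \<Longrightarrow> t \<le> k \<Longrightarrow> T t = T' t) \<Longrightarrow> error_moment Z T k = error_moment Z T' k"
  by (induction k) auto

lemma norm_error_moment_le: "norm (error_moment Z T k) \<le> norm Z"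
  by (induction k) (auto intro: order_trans[OF norm_compress_le])

lemma outer_iterate:
  assumes "\<And>t. 1 \<le> t \<Longrightarrow> t \<le> k \<Longrightarrow> fits (T t) u"
  shows "outer (iterate T k - u) = error_moment (outer u) T k"
  using assms
proof (induction k)
  case 0
  \<comment> \<open>Since the iteration starts at \<open>0\<close>, the first error is
    \<open>- u\<close>; the outer product loses the sign.\<close>
  show ?case by (simp add: outer_def)
next
  case (Suc k)
  have "fits (T (Suc k)) u" using Suc.prems by simp
  with Suc show ?case
    unfolding iterate.simps arg_min_fits[OF \<open>fits (T (Suc k)) u\<close>]
    by (simp add: outer_matrix_vector_mult)
qed

section \<open>Integrating out the tasks one at a time\<close>

context task_distribution
begin

sublocale PD: product_prob_space "\<lambda>_ :: nat. D"
  by (rule product_prob_spaceI) (rule prob_space_axioms)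

abbreviation D_pow :: "nat \<Rightarrow> (nat \<Rightarrow> 'd task) measure" where
  "D_pow k \<equiv> PiM {1..k} (\<lambda>_. D)"

lemma measurable_error_moment:
  assumes "\<And>t. 1 \<le> t \<Longrightarrow> t \<le> k \<Longrightarrow> T t \<in> N \<rightarrow>\<^sub>M D"
  shows "(\<lambda>x. error_moment Z (\<lambda>t. T t x) k) \<in> borel_measurable N"
  using assms
proof (induction k)
  case (Suc k)
  have [measurable]: "(\<lambda>x. error_moment Z (\<lambda>t. T t x) k) \<in> borel_measurable N"
    "T (Suc k) \<in> N \<rightarrow>\<^sub>M D"
    using Suc by auto
  show ?case by simp measurable
qed simp

lemma error_moment_measurable [measurable]:
  "k \<le> m \<Longrightarrow> (\<lambda>x. error_moment Z x k) \<in> borel_measurable (D_pow m)"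
  by (rule measurable_error_moment) auto

lemma integrable_inner_error_moment:
  assumes N: "integrable N A" and Z: "(\<lambda>x. error_moment Z (T x) k) \<in> borel_measurable N"
  shows "integrable N (\<lambda>x. A x \<bullet> error_moment Z (T x) k)"
proof (rule Bochner_Integration.integrable_bound)
  show "integrable N (\<lambda>x. norm (A x) * norm Z)"
    using N by simp
  show "(\<lambda>x. A x \<bullet> error_moment Z (T x) k) \<in> borel_measurable N"
    using N Z by measurable
  have "norm (A x \<bullet> error_moment Z (T x) k) \<le> norm (norm (A x) * norm Z)" for x
    using Cauchy_Schwarz_ineq2[of "A x" "error_moment Z (T x) k"]
      mult_left_mono[OF norm_error_moment_le[of Z "T x" k], of "norm (A x)"] by simp
  then show "AE x in N. norm (A x \<bullet> error_moment Z (T x) k) \<le> norm (norm (A x) * norm Z)"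
    by simp
qed

text \<open>Fubini in the last coordinate: \<open>error_moment Z x k\<close> reads only coordinates
  up to \<open>k\<close>, so only the outermost compression and \<open>A\<close> see the new
  task.\<close>

lemma integral_D_pow_Suc:
  assumes A: "integrable (D_pow (Suc k)) A"
  shows "(\<integral>x. A x \<bullet> error_moment Z x (Suc k) \<partial>D_pow (Suc k)) =
    (\<integral>x. (\<integral>\<tau>. A (x(Suc k := \<tau>)) \<bullet> (nullproj \<tau> ** error_moment Z x k ** nullproj \<tau>) \<partial>D) \<partial>D_pow k)"
proof -
  have ins: "{1..Suc k} = insert (Suc k) {1..k}" by auto
  have "integrable (D_pow (Suc k)) (\<lambda>x. A x \<bullet> error_moment Z x (Suc k))"
    using A by (rule integrable_inner_error_moment) (rule error_moment_measurable, rule order_refl)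
  then have "(\<integral>x. A x \<bullet> error_moment Z x (Suc k) \<partial>D_pow (Suc k)) =
    (\<integral>x. (\<integral>\<tau>. A (x(Suc k := \<tau>)) \<bullet> error_moment Z (x(Suc k := \<tau>)) (Suc k) \<partial>D) \<partial>D_pow k)"
    unfolding ins by (intro PD.product_integral_insert) auto
  moreover have "error_moment Z (x(Suc k := \<tau>)) k = error_moment Z x k" for x \<tau>
    by (rule error_moment_cong) auto
  ultimately show ?thesis by simp
qed

text \<open>When the weight ignores the last task, self-adjointness moves the outermost compression
  onto the weight, where averaging makes it \<open>S_op D\<close>.\<close>

lemma integral_D_pow_Suc_indep:
  assumes A: "integrable (D_pow (Suc k)) A" and indep: "\<And>x \<tau>. A (x(Suc k := \<tau>)) = A x"
  shows "(\<integral>x. A x \<bullet> error_moment Z x (Suc k) \<partial>D_pow (Suc k)) =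
    (\<integral>x. S_op D (A x) \<bullet> error_moment Z x k \<partial>D_pow k)"
proof -
  have "(\<integral>\<tau>. U \<bullet> (nullproj \<tau> ** V ** nullproj \<tau>) \<partial>D) = S_op D U \<bullet> V" for U V
    unfolding S_op_def by (rule inner_integral_compress[symmetric]) simp
  then show ?thesis by (simp only: integral_D_pow_Suc[OF A] indep)
qed

text \<open>The weight is general in the induction because each integration replaces
  \<open>A\<close> by \<open>S_op D A\<close>; self-adjointness then returns the operator to
  \<open>Z\<close>.\<close>

lemma integral_const_error_moment:
  "(\<integral>x. A \<bullet> error_moment Z x k \<partial>D_pow k) = A \<bullet> (S_op D ^^ k) Z"
proof (induction k arbitrary: A)
  case 0
  interpret P: prob_space "D_pow 0" by (rule prob_space_PiM) (rule prob_space_axioms)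
  show ?case using P.prob_space by simp
next
  case (Suc k)
  interpret P: prob_space "D_pow (Suc k)" by (rule prob_space_PiM) (rule prob_space_axioms)
  have "(\<integral>x. A \<bullet> error_moment Z x (Suc k) \<partial>D_pow (Suc k))
      = (\<integral>x. S_op D A \<bullet> error_moment Z x k \<partial>D_pow k)"
    by (rule integral_D_pow_Suc_indep) (rule P.integrable_const, rule refl)
  also have "\<dots> = A \<bullet> (S_op D ^^ Suc k) Z"
    by (simp only: Suc) (simp add: S_op_adjoint)
  finally show ?case .
qed

lemma integrable_D_pow_component:
  fixes A :: "'d task \<Rightarrow> 'b::{banach, second_countable_topology}"
  assumes "integrable D A" "1 \<le> t" "t \<le> k"
  shows "integrable (D_pow k) (\<lambda>x. A (x t))"
proof -
  have "distr (D_pow k) D (\<lambda>x. x t) = D"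
    by (rule distr_PiM_component) (use assms prob_space_axioms in auto)
  then have "integrable (distr (D_pow k) D (\<lambda>x. x t)) A"
    using assms(1) by simp
  then show ?thesis
    using integrable_distr[of "\<lambda>x. x t" "D_pow k" D A] assms by auto
qed

text \<open>Here \<open>m\<close> counts the tasks after task \<open>t\<close>. They are integrated
  out first, each putting one \<open>S_op D\<close> on the weight; then task \<open>t\<close>; then
  the \<open>t - 1\<close> earlier ones, which act on \<open>Z\<close>.\<close>

lemma integral_task_error_moment:
  assumes "integrable D A" "1 \<le> t"
  shows "(\<integral>x. A (x t) \<bullet> error_moment Z x (t + m) \<partial>D_pow (t + m)) =
    (\<integral>\<tau>. (S_op D ^^ m) (A \<tau>) \<bullet> (nullproj \<tau> ** (S_op D ^^ (t - 1)) Z ** nullproj \<tau>) \<partial>D)"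
  using assms(1)
proof (induction m arbitrary: A)
  case 0
  obtain k where k: "t = Suc k" using assms(2) by (cases t) auto
  \<comment> \<open>Task \<open>t\<close> enters both the weight and its own projector, so this
    integration does not produce \<open>S_op D\<close>. It leaves the constant weight
    \<open>B\<close>, to which the previous lemma on constant weights applies.\<close>
  define B where "B = (\<integral>\<tau>. nullproj \<tau> ** A \<tau> ** nullproj \<tau> \<partial>D)"
  have B: "(\<integral>\<tau>. A \<tau> \<bullet> (nullproj \<tau> ** U ** nullproj \<tau>) \<partial>D) = B \<bullet> U" for U
    unfolding B_def by (rule inner_integral_compress[OF 0, symmetric])
  have "(\<integral>x. A (x t) \<bullet> error_moment Z x t \<partial>D_pow t) = (\<integral>x. B \<bullet> error_moment Z x k \<partial>D_pow k)"
    unfolding k using integrable_D_pow_component[OF 0, of "Suc k" "Suc k"]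
    by (subst integral_D_pow_Suc) (simp_all add: B)
  also have "\<dots> = B \<bullet> (S_op D ^^ k) Z" by (rule integral_const_error_moment)
  finally show ?case by (simp add: k B)
next
  case (Suc m)
  have "(\<integral>x. A (x t) \<bullet> error_moment Z x (t + Suc m) \<partial>D_pow (t + Suc m))
      = (\<integral>x. S_op D (A (x t)) \<bullet> error_moment Z x (t + m) \<partial>D_pow (t + m))"
    using integral_D_pow_Suc_indep[of "t + m" "\<lambda>x. A (x t)" Z] assms(2)
      integrable_D_pow_component[OF Suc.prems assms(2), of "t + Suc m"] by simp
  also have "\<dots> = (\<integral>\<tau>. (S_op D ^^ m) (S_op D (A \<tau>)) \<bullet>
      (nullproj \<tau> ** (S_op D ^^ (t - 1)) Z ** nullproj \<tau>) \<partial>D)"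
    by (rule Suc.IH) (rule integrable_bounded_linear[OF bounded_linear_funpow_S_op[of 1, simplified] Suc.prems])
  finally show ?case by (simp only: funpow_Suc_right o_apply)
qed

lemma forgetting_eq:
  fixes M :: "'a measure" and T :: "nat \<Rightarrow> 'a \<Rightarrow> 'd task"
  assumes M: "prob_space M" and ind: "prob_space.indep_vars M (\<lambda>_. D) T {1..}"
    and ident: "\<forall>t\<ge>1. distr M D (T t) = D"
    and fit: "AE \<tau> in D. fits \<tau> w" and cov: "integrable D covmat" and k: "k \<ge> 1"
  shows "forgetting M T k = (1 / real k) * (\<Sum>t=1..k. \<integral>\<tau>. (S_op D ^^ (k - t)) (covmat \<tau>) \<bullet>
    (nullproj \<tau> ** (S_op D ^^ (t - 1)) (outer w) ** nullproj \<tau>) \<partial>D)"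
proof -
  interpret M: prob_space M by (rule M)
  have T [measurable]: "T t \<in> M \<rightarrow>\<^sub>M D" if "t \<ge> 1" for t
    using ind that by (auto simp: M.indep_vars_def2)
  \<comment> \<open>Only the first \<open>k\<close> tasks matter. Bundled as one random element,
    they have law \<open>D_pow k\<close> by independence and identical distribution, which moves the
    computation from \<open>M\<close> to the product space.\<close>
  define J where "J \<omega> = (\<lambda>t\<in>{1..k}. T t \<omega>)" for \<omega>
  have J [measurable]: "J \<in> M \<rightarrow>\<^sub>M D_pow k"
    unfolding J_def by (rule measurable_restrict) (use T in auto)
  have "distr M (D_pow k) J = PiM {1..k} (\<lambda>t. distr M D (T t))"
    unfolding J_def
    by (rule M.indep_vars_iff_distr_eq_PiM'[THEN iffD1])
       (use k T in \<open>auto intro: M.indep_vars_subset[OF ind]\<close>)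
  also have "\<dots> = D_pow k" by (rule PiM_cong) (use ident in auto)
  finally have dist: "distr M (D_pow k) J = D_pow k" .
  have "AE \<omega> in M. fits (T t \<omega>) w" if t: "t \<ge> 1" for t
  proof -
    have "distr M D (T t) = D" using ident t by blast
    with fit have "AE \<tau> in distr M D (T t). fits \<tau> w" by (simp only:)
    then show ?thesis by (rule AE_distrD[OF T[OF t]])
  qed
  then have "AE \<omega> in M. \<forall>t\<in>{1..k}. fits (T t \<omega>) w"
    by (intro AE_finite_allI) auto
  then have ae: "AE \<omega> in M. (1 / real k) * (\<Sum>t=1..k. loss (T t \<omega>) (iterate (\<lambda>s. T s \<omega>) k))
      = (1 / real k) * (\<Sum>t=1..k. covmat (J \<omega> t) \<bullet> error_moment (outer w) (J \<omega>) k)"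
  proof eventually_elim
    case (elim \<omega>)
    have "outer (iterate (\<lambda>s. T s \<omega>) k - w) = error_moment (outer w) (\<lambda>s. T s \<omega>) k"
      using elim by (intro outer_iterate) auto
    also have "\<dots> = error_moment (outer w) (J \<omega>) k"
      by (rule error_moment_cong) (simp add: J_def)
    finally show ?case
      using elim by (intro arg_cong2[of _ _ _ _ "(*)"] sum.cong)
        (auto simp: loss_eq_inner_covmat[of _ w] J_def)
  qed
  have TS: "T t \<in> M \<rightarrow>\<^sub>M task_space" if "t \<ge> 1" for t
    using T[OF that] by (simp add: measurable_cong_sets[OF refl sets_D])
  have cm [measurable]: "covmat \<in> borel_measurable D" using cov by auto
  have Jt: "(\<lambda>\<omega>. J \<omega> t) \<in> M \<rightarrow>\<^sub>M D" if "t \<in> {1..k}" for t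
    using that T by (auto simp: J_def)
  have int: "integrable (D_pow k) (\<lambda>x. covmat (x t) \<bullet> error_moment (outer w) x k)"
    if "t \<in> {1..k}" for t
    using that
    by (intro integrable_inner_error_moment integrable_D_pow_component cov
        error_moment_measurable[OF order_refl]) auto
  \<comment> \<open>The integrands agree only almost everywhere, so both must be measurable; for the
    original one this uses measurability of \<open>arg_min\<close> even on infeasible
    systems.\<close>
  have "forgetting M T k =
      (\<integral>\<omega>. (1 / real k) * (\<Sum>t=1..k. covmat (J \<omega> t) \<bullet> error_moment (outer w) (J \<omega>) k) \<partial>M)"
    unfolding forgetting_def
  proof (rule integral_cong_AE[OF _ _ ae])
    show "(\<lambda>\<omega>. (1 / real k) * (\<Sum>t=1..k. loss (T t \<omega>) (iterate (\<lambda>s. T s \<omega>) k))) \<in> borel_measurable M"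
      using TS by (intro borel_measurable_times borel_measurable_sum measurable_loss measurable_iterate) auto
    have "(\<lambda>\<omega>. error_moment (outer w) (J \<omega>) k) \<in> borel_measurable M"
      by (rule measurable_compose[OF J error_moment_measurable[OF order_refl]])
    then show "(\<lambda>\<omega>. (1 / real k) * (\<Sum>t=1..k. covmat (J \<omega> t) \<bullet> error_moment (outer w) (J \<omega>) k)) \<in> borel_measurable M"
      by (intro borel_measurable_times borel_measurable_sum borel_measurable_inner
          measurable_compose[OF Jt cm]) auto
  qed
  also have "\<dots> = (\<integral>x. (1 / real k) * (\<Sum>t=1..k. covmat (x t) \<bullet> error_moment (outer w) x k) \<partial>distr M (D_pow k) J)"
    using int by (intro integral_distr[symmetric] J) auto
  also have "\<dots> = (1 / real k) * (\<Sum>t=1..k. \<integral>x. covmat (x t) \<bullet> error_moment (outer w) x k \<partial>D_pow k)"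
    unfolding dist using int by (simp add: Bochner_Integration.integral_sum)
  also have "(\<Sum>t=1..k. \<integral>x. covmat (x t) \<bullet> error_moment (outer w) x k \<partial>D_pow k) =
      (\<Sum>t=1..k. \<integral>\<tau>. (S_op D ^^ (k - t)) (covmat \<tau>) \<bullet>
        (nullproj \<tau> ** (S_op D ^^ (t - 1)) (outer w) ** nullproj \<tau>) \<partial>D)"
  proof (rule sum.cong[OF refl])
    fix t assume "t \<in> {1..k}"
    then show "(\<integral>x. covmat (x t) \<bullet> error_moment (outer w) x k \<partial>D_pow k) =
      (\<integral>\<tau>. (S_op D ^^ (k - t)) (covmat \<tau>) \<bullet>
        (nullproj \<tau> ** (S_op D ^^ (t - 1)) (outer w) ** nullproj \<tau>) \<partial>D)"
      using integral_task_error_moment[OF cov, where t = t and Z = "outer w" and m = "k - t"] by simp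
  qed
  finally show ?thesis .
qed

end

section \<open>Rate of forgetting\<close>

lemma covmat_Sym: "covmat \<tau> \<in> Sym"
  by (simp add: covmat_def Sym_def transpose_scalar transpose_mat_BX)

lemma outer_Sym: "outer v \<in> Sym"
  by (simp add: outer_def Sym_def transpose_def vec_eq_iff mult.commute)

lemma Q_top_eq: "Q_top D = orth_proj (E_top D)"
  by (simp add: fun_eq_iff Q_top_def orth_proj_def)

context task_distribution
begin

lemma subspace_E_top: "subspace (E_top D)"
  and norm_funpow_S_op_diff_le:
    "A \<in> Sym \<Longrightarrow> norm ((S_op D ^^ m) A - rho D ^ m *\<^sub>R Q_top D A) \<le> eta D ^ m * norm A"
proof -
  note gap = funpow_eigen_gap[OF linear_S_op S_op_adjoint subspace_Sym S_op_Sym E_top_def]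
  \<comment> \<open>The gap lemma also asks for an element of \<open>Sym\<close>; the zero matrix
    supplies it.\<close>
  show "subspace (E_top D)" by (rule gap(2)[of 0]) (simp_all add: subspace_0 subspace_Sym)
  show "A \<in> Sym \<Longrightarrow> norm ((S_op D ^^ m) A - rho D ^ m *\<^sub>R Q_top D A) \<le> eta D ^ m * norm A"
    unfolding Q_top_eq eta_def by (rule gap(1))
qed

lemma norm_Q_top_le: "norm (Q_top D A) \<le> norm A"
  unfolding Q_top_eq by (rule norm_orth_proj_le[OF subspace_E_top])

lemma rho_nonneg: "0 \<le> rho D"
  unfolding rho_def by (rule onorm_on_nonneg[OF linear_S_op]) (simp add: subspace_0 subspace_Sym)

lemma eta_nonneg: "0 \<le> eta D"
  unfolding eta_def
  by (rule onorm_on_nonneg[OF linear_S_op])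
     (simp add: subspace_0 subspace_Sym subspace_orthogonal_comp)

lemma norm_funpow_S_op_le: "A \<in> Sym \<Longrightarrow> norm ((S_op D ^^ m) A) \<le> rho D ^ m * norm A"
  unfolding rho_def
  by (rule norm_funpow_le[OF linear_S_op S_op_Sym]) (simp_all add: subspace_0 subspace_Sym)

text \<open>\<open>trace (A ** B)\<close> is the Frobenius product with \<open>A\<close> transposed,
  and the transpose disappears because \<open>Q_top D\<close> takes values in
  \<open>Sym\<close>.\<close>

lemma c_top_eq:
  "c_top D w = (\<integral>\<tau>. Q_top D (covmat \<tau>) \<bullet> (nullproj \<tau> ** Q_top D (outer w) ** nullproj \<tau>) \<partial>D)"
proof -
  have "transpose (Q_top D A) = Q_top D A" for A
    using orth_proj(1)[OF subspace_E_top, of A] by (simp add: Q_top_eq E_top_def Sym_def)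
  then show ?thesis
    by (simp add: c_top_def trace_matrix_mult flip: matrix_mul_assoc)
qed

text \<open>\<open>i\<close> is the number of tasks after the scored one and \<open>j\<close> the
  number before it. The estimate is pointwise in the task and linear in
  \<open>norm (covmat \<tau>)\<close>, so a first moment suffices to integrate it.\<close>

lemma task_loss_gap:
  assumes cov: "integrable D covmat"
  shows "\<bar>(\<integral>\<tau>. (S_op D ^^ i) (covmat \<tau>) \<bullet> (nullproj \<tau> ** (S_op D ^^ j) (outer w) ** nullproj \<tau>) \<partial>D)
      - rho D ^ (i + j) * c_top D w\<bar>
    \<le> (\<integral>\<tau>. norm (covmat \<tau>) \<partial>D) * norm (outer w) * (eta D ^ i * rho D ^ j + rho D ^ i * eta D ^ j)"
proof -
  define f where "f \<tau> = (S_op D ^^ i) (covmat \<tau>) \<bullet> (nullproj \<tau> ** (S_op D ^^ j) (outer w) ** nullproj \<tau>)" for \<tau>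
  define g where "g \<tau> = Q_top D (covmat \<tau>) \<bullet> (nullproj \<tau> ** Q_top D (outer w) ** nullproj \<tau>)" for \<tau>
  define e where "e = norm (outer w) * (eta D ^ i * rho D ^ j + rho D ^ i * eta D ^ j)"
  have "integrable D (\<lambda>\<tau>. (S_op D ^^ i) (covmat \<tau>))"
    by (rule integrable_bounded_linear[OF bounded_linear_funpow_S_op cov])
  then have f: "integrable D f"
    unfolding f_def by (rule integrable_inner_compress[OF _ _ order_refl]) simp
  have "bounded_linear (Q_top D)"
    unfolding Q_top_eq linear_conv_bounded_linear[symmetric] by (rule linear_orth_proj[OF subspace_E_top])
  then have "integrable D (\<lambda>\<tau>. Q_top D (covmat \<tau>))"
    by (rule integrable_bounded_linear[OF _ cov])
  then have g: "integrable D g"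
    unfolding g_def by (rule integrable_inner_compress[OF _ _ order_refl]) simp
  have bound: "\<bar>f \<tau> - rho D ^ (i + j) * g \<tau>\<bar> \<le> norm (covmat \<tau>) * e" for \<tau>
  proof -
    define P where "P A = nullproj \<tau> ** A ** nullproj \<tau>" for A
    define C X where "C = covmat \<tau>" and "X = outer w"
    define C' X' where "C' = rho D ^ i *\<^sub>R Q_top D C" and "X' = rho D ^ j *\<^sub>R Q_top D X"
    have lin: "linear P" unfolding P_def by (rule linear_compress)
    have P_le: "norm (P A) \<le> norm A" for A unfolding P_def by (rule norm_compress_le) simp_all
    have sym: "C \<in> Sym" "X \<in> Sym" by (simp_all add: C_def X_def covmat_Sym outer_Sym)
    have "f \<tau> - rho D ^ (i + j) * g \<tau> = (S_op D ^^ i) C \<bullet> P ((S_op D ^^ j) X) - C' \<bullet> P X'"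
      unfolding f_def g_def X'_def linear_scale[OF lin]
      by (simp add: C'_def C_def P_def X_def power_add)
    \<comment> \<open>The two factors are replaced one after the other: the factor being replaced
      contributes a power of \<open>eta D\<close>, the other a power of
      \<open>rho D\<close>.\<close>
    also have "\<dots> = ((S_op D ^^ i) C - C') \<bullet> P ((S_op D ^^ j) X) + C' \<bullet> P ((S_op D ^^ j) X - X')"
      by (simp add: linear_diff[OF lin] inner_diff_left inner_diff_right)
    also have "\<bar>\<dots>\<bar> \<le> norm ((S_op D ^^ i) C - C') * norm (P ((S_op D ^^ j) X))
        + norm C' * norm (P ((S_op D ^^ j) X - X'))"
      by (intro order_trans[OF abs_triangle_ineq] add_mono Cauchy_Schwarz_ineq2)
    also have "\<dots> \<le> (eta D ^ i * norm C) * (rho D ^ j * norm X) + (rho D ^ i * norm C) * (eta D ^ j * norm X)"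
    proof (intro add_mono mult_mono)
      show "norm ((S_op D ^^ i) C - C') \<le> eta D ^ i * norm C"
        unfolding C'_def by (rule norm_funpow_S_op_diff_le[OF sym(1)])
      show "norm (P ((S_op D ^^ j) X)) \<le> rho D ^ j * norm X"
        by (rule order_trans[OF P_le norm_funpow_S_op_le[OF sym(2)]])
      show "norm C' \<le> rho D ^ i * norm C"
        using rho_nonneg norm_Q_top_le[of C] by (simp add: C'_def mult_left_mono)
      show "norm (P ((S_op D ^^ j) X - X')) \<le> eta D ^ j * norm X"
        unfolding X'_def by (rule order_trans[OF P_le norm_funpow_S_op_diff_le[OF sym(2)]])
    qed (simp_all add: rho_nonneg eta_nonneg)
    also have "\<dots> = norm (covmat \<tau>) * e" by (simp add: e_def C_def X_def algebra_simps)
    finally show ?thesis .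
  qed
  have "(\<integral>\<tau>. f \<tau> \<partial>D) - rho D ^ (i + j) * c_top D w = (\<integral>\<tau>. f \<tau> - rho D ^ (i + j) * g \<tau> \<partial>D)"
    using f g by (simp add: c_top_eq g_def[symmetric])
  also have "\<bar>\<dots>\<bar> \<le> (\<integral>\<tau>. \<bar>f \<tau> - rho D ^ (i + j) * g \<tau>\<bar> \<partial>D)"
    by (rule integral_abs_bound)
  also have "\<dots> \<le> (\<integral>\<tau>. norm (covmat \<tau>) * e \<partial>D)"
    using f g cov by (intro integral_mono bound) auto
  finally show ?thesis by (simp add: f_def e_def mult.assoc)
qed

lemma forgetting_gap:
  assumes "prob_space M" "prob_space.indep_vars M (\<lambda>_. D) T {1..}" "\<forall>t\<ge>1. distr M D (T t) = D"
    and "AE \<tau> in D. fits \<tau> w" and cov: "integrable D covmat" and k: "k \<ge> 1"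
    and gap: "eta D < rho D"
  shows "\<bar>forgetting M T k - rho D ^ (k - 1) * c_top D w\<bar> \<le> rho D ^ (k - 1) *
    (2 * (\<integral>\<tau>. norm (covmat \<tau>) \<partial>D) * norm (outer w) / (1 - eta D / rho D) / real k)"
proof -
  \<comment> \<open>The gap and \<open>eta D \<ge> 0\<close> give \<open>rho D > 0\<close>.
    Factoring \<open>rho D ^ (k - 1)\<close> out of the errors leaves powers of the ratio
    \<open>q < 1\<close>.\<close>
  define r q where "r = rho D" and "q = eta D / rho D"
  define K where "K = (\<integral>\<tau>. norm (covmat \<tau>) \<partial>D) * norm (outer w)"
  define G where "G t = (\<integral>\<tau>. (S_op D ^^ (k - t)) (covmat \<tau>) \<bullet>
    (nullproj \<tau> ** (S_op D ^^ (t - 1)) (outer w) ** nullproj \<tau>) \<partial>D)" for t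
  have r: "r > 0" and q: "0 \<le> q" "q < 1"
    using gap eta_nonneg by (auto simp: r_def q_def)
  have eta: "eta D = q * r" using r by (simp add: q_def r_def)
  have K: "K \<ge> 0" by (simp add: K_def)
  have G: "\<bar>G t - r ^ (k - 1) * c_top D w\<bar> \<le> K * r ^ (k - 1) * (q ^ (k - t) + q ^ (t - 1))"
    if t: "t \<in> {1..k}" for t
  proof -
    have "(k - t) + (t - 1) = k - 1" using t by auto
    then have "\<bar>G t - r ^ (k - 1) * c_top D w\<bar>
        \<le> K * (eta D ^ (k - t) * r ^ (t - 1) + r ^ (k - t) * eta D ^ (t - 1))"
      using task_loss_gap[OF cov, of "k - t" "t - 1" w] by (simp only: G_def K_def r_def)
    also have "eta D ^ (k - t) * r ^ (t - 1) + r ^ (k - t) * eta D ^ (t - 1)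
        = r ^ (k - t) * r ^ (t - 1) * (q ^ (k - t) + q ^ (t - 1))"
      by (simp add: eta power_mult_distrib algebra_simps)
    also have "r ^ (k - t) * r ^ (t - 1) = r ^ (k - 1)"
      by (simp only: power_add[symmetric] \<open>(k - t) + (t - 1) = k - 1\<close>)
    finally show ?thesis by (simp only: mult.assoc)
  qed
  have geo: "(\<Sum>i<k. q ^ i) \<le> 1 / (1 - q)"
    using q by (simp add: sum_gp_strict divide_right_mono)
  \<comment> \<open>Both sums run through the exponents \<open>0\<close> to \<open>k - 1\<close>, in
    opposite orders. Their geometric bound is independent of \<open>k\<close>, so the average over
    \<open>t\<close> gains a factor \<open>1 / k\<close>.\<close>
  have "(\<Sum>t=1..k. q ^ (t - 1)) = (\<Sum>i<k. q ^ i)"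
    by (rule sum.reindex_bij_witness[of _ Suc "\<lambda>t. t - 1"]) auto
  moreover have "(\<Sum>t=1..k. q ^ (k - t)) = (\<Sum>i<k. q ^ i)"
    by (rule sum.reindex_bij_witness[of _ "\<lambda>i. k - i" "\<lambda>t. k - t"]) auto
  ultimately have sum: "(\<Sum>t=1..k. q ^ (k - t) + q ^ (t - 1)) \<le> 2 / (1 - q)"
    using geo by (simp add: sum.distrib)
  have "forgetting M T k - r ^ (k - 1) * c_top D w
      = (1 / real k) * (\<Sum>t=1..k. G t - r ^ (k - 1) * c_top D w)"
    using forgetting_eq[OF assms(1-4) cov k] k
    by (simp add: G_def sum_subtractf right_diff_distrib)
  also have "\<bar>\<dots>\<bar> \<le> (1 / real k) * (\<Sum>t=1..k. K * r ^ (k - 1) * (q ^ (k - t) + q ^ (t - 1)))"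
    unfolding abs_mult using G
    by (intro mult_mono order_trans[OF sum_abs] sum_mono) (auto intro: sum_nonneg)
  also have "\<dots> = (1 / real k) * (K * r ^ (k - 1) * (\<Sum>t=1..k. q ^ (k - t) + q ^ (t - 1)))"
    by (simp add: sum_distrib_left)
  also have "\<dots> \<le> (1 / real k) * (K * r ^ (k - 1) * (2 / (1 - q)))"
    using sum K r by (intro mult_left_mono) auto
  finally show ?thesis
    by (simp add: K_def r_def q_def mult_ac)
qed

end

theorem mainTheorem4:
  fixes D :: "'d::finite task measure"
    and M :: "'a measure"
    and T :: "nat \<Rightarrow> 'a \<Rightarrow> 'd task"
    and w :: "real^'d"
  assumes "prob_space D" and "sets D = sets task_space"
    and "AE \<tau> in D. fits \<tau> w"
    and "integrable D covmat"
    and "prob_space M"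
    and "prob_space.indep_vars M (\<lambda>_. D) T {1..}"
    and "\<forall>t\<ge>1. distr M D (T t) = D"
    and "eta D < rho D" and "rho D < 1"
    and "c_top D w > 0"
  shows "\<exists>a b :: real. \<exists>k0 \<ge> (1::nat). 0 < a \<and> a \<le> b \<and>
           (\<forall>k\<ge>k0. a * rho D ^ (k - 1) \<le> forgetting M T k \<and>
                    forgetting M T k \<le> b * rho D ^ (k - 1))"
proof -
  interpret prob_space D by (rule assms(1))
  interpret task_distribution D by unfold_locales (rule assms(2))
  define L where "L = 2 * (\<integral>\<tau>. norm (covmat \<tau>) \<partial>D) * norm (outer w) / (1 - eta D / rho D)"
  define c where "c = c_top D w"
  have c: "c > 0" using assms(10) by (simp add: c_def)
  have "(\<lambda>k. L / real k) \<longlonglongrightarrow> 0" by (rule lim_const_over_n)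
  \<comment> \<open>Once the error relative to \<open>rho D ^ (k - 1)\<close> is below
    \<open>c / 2\<close>, the forgetting lies between \<open>c / 2\<close> and
    \<open>3 * c / 2\<close> times that power.\<close>
  then have "\<forall>\<^sub>F k in sequentially. L / real k < c / 2"
    using c by (intro order_tendstoD) auto
  then obtain k1 where k1: "\<And>k. k \<ge> k1 \<Longrightarrow> L / real k < c / 2"
    by (auto simp: eventually_sequentially)
  have "c / 2 * rho D ^ (k - 1) \<le> forgetting M T k \<and> forgetting M T k \<le> 3 * c / 2 * rho D ^ (k - 1)"
    if k: "k \<ge> max 1 k1" for k
  proof -
    have "\<bar>forgetting M T k - rho D ^ (k - 1) * c\<bar> \<le> rho D ^ (k - 1) * (L / real k)"
      using forgetting_gap[OF assms(5-7,3,4) _ assms(8)] k by (simp add: L_def c_def)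
    also have "\<dots> \<le> rho D ^ (k - 1) * (c / 2)"
      using k k1[of k] rho_nonneg by (intro mult_left_mono) auto
    finally have "\<bar>forgetting M T k - rho D ^ (k - 1) * c\<bar> \<le> rho D ^ (k - 1) * c / 2"
      by simp
    then have "rho D ^ (k - 1) * c / 2 \<le> forgetting M T k"
      "forgetting M T k \<le> 3 * (rho D ^ (k - 1) * c) / 2"
      by linarith+
    then show ?thesis by (simp add: mult_ac)
  qed
  then show ?thesis
    using c by (intro exI[of _ "c / 2"] exI[of _ "3 * c / 2"] exI[of _ "max 1 k1"]) auto
qed

end
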